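(* Let $q\ge 2$ be an integer and $f,g\in L^\infty(\mathbb{T})$. Then $\Gamma_q[\bar f]\Gamma_q[g]-\Gamma_q[\bar f g]$ is a compact operator on $\ell^2(T_q)$ if and only if $\Gamma_q[\bar f]\Gamma_q[g]=\Gamma_q[\bar f g]$, and hence if and only if either $f\in H^\infty(\mathbb{T})$ or $g\in H^\infty(\mathbb{T})$.
   Context: $T_q$ denotes the (vertex set of the) infinite rooted $q$-homogeneous tree: there is a root $o$, and each vertex has exactly $q$ children. $d$ is the graph distance and $|\sigma| := d(o,\sigma)$. Write $\sigma_1\preccurlyeq\sigma_2$ if $\sigma_1,\sigma_2$ lie on a common geodesic ray starting at the root and $|\sigma_1|\le|\sigma_2|$. Let $\mathcal{C}\subset T_q\times T_q$ be the set of comparable pairs ($\sigma_1\preccurlyeq\sigma_2$ or $\sigma_2\preccurlyeq\sigma_1$), with indicator function $\mathbf{1}_{\mathcal{C}}$. $\mathbb{T}=\mathbb{R}/2\pi\mathbb{Z}$. For $f\in L^\infty(\mathbb{T})$, $\widehat f(n)=\int_{\mathbb{T}} f(e^{i\theta})e^{-in\theta}\frac{d\theta}{2\pi}$, and $$\Gamma_q[f](\sigma_1,\sigma_2) := q^{-d(\sigma_1,\sigma_2)/2}\,\widehat f(|\sigma_1|-|\sigma_2|)\,\mathbf{1}_{\mathcal{C}}(\sigma_1,\sigma_2).$$ Bounded operators $A$ on $\ell^2(T_q)$ are identified with their kernels $A(\sigma_1,\sigma_2)=\langle A\delta_{\sigma_2},\delta_{\sigma_1}\rangle$; for every $f\in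 L^\infty(\mathbb{T})$ the kernel $\Gamma_q[f]$ represents a bounded operator on $\ell^2(T_q)$. $H^\infty(\mathbb{T})=\{f\in L^\infty(\mathbb{T}) : \widehat f(n)=0 \text{ for all } n<0\}$. *)

theory Defs
  imports "HOL-Analysis.Analysis"
begin

typedef 'a ell2 = "{a :: 'a \<Rightarrow> complex. (\<lambda>x. (cmod (a x))\<^sup>2) summable_on UNIV}"
  morphisms ell2_coord Abs_ell2
  by (rule exI[of _ "\<lambda>_. 0"]) simp

setup_lifting type_definition_ell2

lemma summable_ell2_add:
  fixes a b :: "'a \<Rightarrow> complex"
  assumes "(\<lambda>x. (cmod (a x))\<^sup>2) summable_on UNIV" "(\<lambda>x. (cmod (b x))\<^sup>2) summable_on UNIV"
  shows "(\<lambda>x. (cmod (a x + b x))\<^sup>2) summable_on UNIV"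
proof (rule summable_on_comparison_test)
  show "(\<lambda>x. 2 * (cmod (a x))\<^sup>2 + 2 * (cmod (b x))\<^sup>2) summable_on UNIV"
    by (intro summable_on_add summable_on_cmult_right assms)
  fix x
  have "(cmod (a x + b x))\<^sup>2 \<le> (cmod (a x) + cmod (b x))\<^sup>2"
    by (intro power_mono norm_triangle_ineq) auto
  also have "\<dots> \<le> 2 * (cmod (a x))\<^sup>2 + 2 * (cmod (b x))\<^sup>2"
    using sum_squares_bound[of "cmod (a x)" "cmod (b x)"] by (simp add: power2_sum)
  finally show "(cmod (a x + b x))\<^sup>2 \<le> 2 * (cmod (a x))\<^sup>2 + 2 * (cmod (b x))\<^sup>2" .
qed auto

lemma summable_ell2_scale:
  fixes a :: "'a \<Rightarrow> complex"
  assumes "(\<lambda>x. (cmod (a x))\<^sup>2) summable_on UNIV"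
  shows "(\<lambda>x. (cmod (c * a x))\<^sup>2) summable_on UNIV"
  using summable_on_cmult_right[OF assms, of "(cmod c)\<^sup>2"]
  by (simp add: norm_mult power_mult_distrib)

lemma summable_ell2_mult:
  fixes a b :: "'a \<Rightarrow> complex"
  assumes "(\<lambda>x. (cmod (a x))\<^sup>2) summable_on UNIV" "(\<lambda>x. (cmod (b x))\<^sup>2) summable_on UNIV"
  shows "(\<lambda>x. a x * cnj (b x)) summable_on UNIV"
proof -
  have "(\<lambda>x. cmod (a x * cnj (b x))) summable_on UNIV"
  proof (rule summable_on_comparison_test)
    show "(\<lambda>x. (cmod (a x))\<^sup>2 + (cmod (b x))\<^sup>2) summable_on UNIV"
      by (intro summable_on_add assms)
    fix x
    have "0 \<le> cmod (a x) * cmod (b x)"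
      by simp
    then have "cmod (a x) * cmod (b x) \<le> 2 * cmod (a x) * cmod (b x)"
      by simp
    also have "\<dots> \<le> (cmod (a x))\<^sup>2 + (cmod (b x))\<^sup>2"
      by (rule sum_squares_bound)
    finally show "cmod (a x * cnj (b x)) \<le> (cmod (a x))\<^sup>2 + (cmod (b x))\<^sup>2"
      by (simp add: norm_mult)
  qed auto
  then show ?thesis
    by (rule abs_summable_summable)
qed

lift_definition ell2_scale :: "complex \<Rightarrow> 'a ell2 \<Rightarrow> 'a ell2" is "\<lambda>c a x. c * a x"
  by (rule summable_ell2_scale)

lift_definition ell2_cinner :: "'a ell2 \<Rightarrow> 'a ell2 \<Rightarrow> complex"
  is "\<lambda>a b. \<Sum>\<^sub>\<infinity>x. a x * cnj (b x)" .

lift_definition ell2_delta :: "'a \<Rightarrow> 'a ell2" is "\<lambda>x y. if y = x then 1 else 0"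
proof -
  fix x :: 'a
  show "(\<lambda>y. (cmod (if y = x then 1 else 0))\<^sup>2) summable_on UNIV"
    by (rule finite_nonzero_values_imp_summable_on) simp
qed

instantiation ell2 :: (type) real_inner
begin

lift_definition zero_ell2 :: "'a ell2" is "\<lambda>_. 0" by simp

lift_definition plus_ell2 :: "'a ell2 \<Rightarrow> 'a ell2 \<Rightarrow> 'a ell2" is "\<lambda>a b x. a x + b x"
  by (rule summable_ell2_add)

lift_definition uminus_ell2 :: "'a ell2 \<Rightarrow> 'a ell2" is "\<lambda>a x. - a x" by simp

lift_definition minus_ell2 :: "'a ell2 \<Rightarrow> 'a ell2 \<Rightarrow> 'a ell2" is "\<lambda>a b x. a x - b x"
  using summable_ell2_add[of _ "\<lambda>x. - _ x"] by fastforce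

lift_definition scaleR_ell2 :: "real \<Rightarrow> 'a ell2 \<Rightarrow> 'a ell2" is "\<lambda>r a x. of_real r * a x"
  by (rule summable_ell2_scale)

definition inner_ell2 :: "'a ell2 \<Rightarrow> 'a ell2 \<Rightarrow> real"
  where "inner_ell2 a b = Re (ell2_cinner a b)"

definition norm_ell2 :: "'a ell2 \<Rightarrow> real"
  where "norm_ell2 a = sqrt (inner a a)"

definition sgn_ell2 :: "'a ell2 \<Rightarrow> 'a ell2"
  where "sgn_ell2 a = scaleR (inverse (norm a)) a"

definition dist_ell2 :: "'a ell2 \<Rightarrow> 'a ell2 \<Rightarrow> real"
  where "dist_ell2 a b = norm (a - b)"

definition uniformity_ell2 :: "('a ell2 \<times> 'a ell2) filter"
  where "uniformity_ell2 = (INF e\<in>{0 <..}. principal {(x, y). dist x y < e})"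

definition open_ell2 :: "'a ell2 set \<Rightarrow> bool"
  where "open_ell2 U = (\<forall>x\<in>U. eventually (\<lambda>(x', y). x' = x \<longrightarrow> y \<in> U) uniformity)"

instance
proof
  fix a b c :: "'a ell2" and r s :: real and U :: "'a ell2 set"
  show "a + b + c = a + (b + c)" by transfer (auto simp: algebra_simps)
  show "a + b = b + a" by transfer (auto simp: algebra_simps)
  show "0 + a = a" by transfer auto
  show "- a + a = 0" by transfer auto
  show "a - b = a + - b" by transfer auto
  show "r *\<^sub>R (a + b) = r *\<^sub>R a + r *\<^sub>R b" by transfer (auto simp: algebra_simps)
  show "(r + s) *\<^sub>R a = r *\<^sub>R a + s *\<^sub>R a" by transfer (auto simp: algebra_simps)
  show "r *\<^sub>R s *\<^sub>R a = (r * s) *\<^sub>R a" by transfer (auto simp: algebra_simps)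
  show "1 *\<^sub>R a = a" by transfer auto
  show "dist a b = norm (a - b)" by (rule dist_ell2_def)
  show "sgn a = scaleR (inverse (norm a)) a" by (rule sgn_ell2_def)
  show "uniformity = (INF e\<in>{0 <..}. principal {(x :: 'a ell2, y). dist x y < e})"
    by (rule uniformity_ell2_def)
  show "open U = (\<forall>x\<in>U. eventually (\<lambda>(x', y). x' = x \<longrightarrow> y \<in> U) uniformity)"
    by (rule open_ell2_def)
  show "norm a = sqrt (inner a a)" by (rule norm_ell2_def)
  show "inner a b = inner b a"
    unfolding inner_ell2_def
  proof transfer
    fix a b :: "'a \<Rightarrow> complex"
    have "(\<Sum>\<^sub>\<infinity>x. b x * cnj (a x)) = (\<Sum>\<^sub>\<infinity>x. cnj (a x * cnj (b x)))"
      by (simp add: mult.commute)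
    also have "\<dots> = cnj (\<Sum>\<^sub>\<infinity>x. a x * cnj (b x))"
      by (rule infsum_cnj)
    finally show "Re (\<Sum>\<^sub>\<infinity>x. a x * cnj (b x)) = Re (\<Sum>\<^sub>\<infinity>x. b x * cnj (a x))"
      by simp
  qed
  show "inner (a + b) c = inner a c + inner b c"
    unfolding inner_ell2_def
    by transfer (simp add: ring_distribs infsum_add summable_ell2_mult)
  show "inner (r *\<^sub>R a) b = r * inner a b"
    unfolding inner_ell2_def
    by transfer (simp add: mult.assoc infsum_cmult_right')
  have inner_self: "inner a a = (\<Sum>\<^sub>\<infinity>x. (cmod (ell2_coord a x))\<^sup>2)" for a :: "'a ell2"
    unfolding inner_ell2_def
  proof transfer
    fix a :: "'a \<Rightarrow> complex"
    assume sm: "(\<lambda>x. (cmod (a x))\<^sup>2) summable_on UNIV"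
    have "Re (\<Sum>\<^sub>\<infinity>x. a x * cnj (a x)) = (\<Sum>\<^sub>\<infinity>x. Re (a x * cnj (a x)))"
      by (rule infsum_Re[symmetric]) (rule summable_ell2_mult[OF sm sm])
    also have "\<dots> = (\<Sum>\<^sub>\<infinity>x. (cmod (a x))\<^sup>2)"
      by (simp add: cmod_power2 flip: power2_eq_square)
    finally show "Re (\<Sum>\<^sub>\<infinity>x. a x * cnj (a x)) = (\<Sum>\<^sub>\<infinity>x. (cmod (a x))\<^sup>2)" .
  qed
  show "0 \<le> inner a a"
    unfolding inner_self by (rule infsum_nonneg) auto
  show "inner a a = 0 \<longleftrightarrow> a = 0"
    unfolding inner_self
  proof transfer
    fix a :: "'a \<Rightarrow> complex"
    assume sm: "(\<lambda>x. (cmod (a x))\<^sup>2) summable_on UNIV"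
    show "((\<Sum>\<^sub>\<infinity>x. (cmod (a x))\<^sup>2) = 0) = (a = (\<lambda>_. 0))"
    proof
      assume "(\<Sum>\<^sub>\<infinity>x. (cmod (a x))\<^sup>2) = 0"
      then have "(cmod (a x))\<^sup>2 = 0" for x
        using nonneg_infsum_le_0D[OF _ sm, of x] by simp
      then show "a = (\<lambda>_. 0)" by auto
    qed simp
  qed
qed

end

text \<open>The predicate \<^const>\<open>bounded_linear\<close> only expresses real linearity.\<close>

definition bounded_clinear_ell2 :: "('a ell2 \<Rightarrow> 'b ell2) \<Rightarrow> bool" where
  "bounded_clinear_ell2 A \<longleftrightarrow>
     bounded_linear A \<and> (\<forall>c x. A (ell2_scale c x) = ell2_scale c (A x))"

definition compact_operator_ell2 :: "('a ell2 \<Rightarrow> 'b ell2) \<Rightarrow> bool" where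
  "compact_operator_ell2 A \<longleftrightarrow>
     bounded_clinear_ell2 A \<and> compact (closure (A ` cball 0 1))"

definition ell2_kernel :: "('a ell2 \<Rightarrow> 'a ell2) \<Rightarrow> 'a \<Rightarrow> 'a \<Rightarrow> complex" where
  "ell2_kernel A x y = ell2_cinner (A (ell2_delta y)) (ell2_delta x)"

text \<open>A bounded operator is determined by its kernel. The description is meaningful only
  for kernels that are represented by some bounded operator.\<close>

definition operator_of_kernel :: "('a \<Rightarrow> 'a \<Rightarrow> complex) \<Rightarrow> 'a ell2 \<Rightarrow> 'a ell2" where
  "operator_of_kernel K = (THE A. bounded_clinear_ell2 A \<and> ell2_kernel A = K)"

text \<open>For a finite type \<^typ>\<open>'q\<close> with \<open>q\<close> elements, the vertices of the rooted
  \<open>q\<close>-homogeneous tree are the finite words over \<^typ>\<open>'q\<close>. The root is the empty word, and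
  the \<open>q\<close> children of \<open>s\<close> are the words \<open>s @ [i]\<close>.\<close>

type_synonym 'q tree = "'q list"

definition tree_edges :: "('q tree \<times> 'q tree) set" where
  "tree_edges = {(s, t). (\<exists>i. t = s @ [i]) \<or> (\<exists>i. s = t @ [i])}"

definition tree_dist :: "'q tree \<Rightarrow> 'q tree \<Rightarrow> nat" where
  "tree_dist s t = (LEAST n. (s, t) \<in> tree_edges ^^ n)"

definition tree_level :: "'q tree \<Rightarrow> nat" where
  "tree_level s = tree_dist [] s"

definition root_geodesic_ray :: "(nat \<Rightarrow> 'q tree) \<Rightarrow> bool" where
  "root_geodesic_ray r \<longleftrightarrow>
     r 0 = [] \<and> (\<forall>m n. int (tree_dist (r m) (r n)) = \<bar>int m - int n\<bar>)"

definition tree_le :: "'q tree \<Rightarrow> 'q tree \<Rightarrow> bool" where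
  "tree_le s t \<longleftrightarrow>
     (\<exists>r. root_geodesic_ray r \<and> s \<in> range r \<and> t \<in> range r) \<and> tree_level s \<le> tree_level t"

definition comparable_pairs :: "('q tree \<times> 'q tree) set" where
  "comparable_pairs = {(s, t). tree_le s t \<or> tree_le t s}"

text \<open>Elements of \<open>L\<^sup>\<infinity>\<close> are given by representatives \<open>f\<close>; only the values of \<open>f\<close> on the
  unit circle matter, and these only up to null sets.\<close>

definition Linf_circle :: "(complex \<Rightarrow> complex) set" where
  "Linf_circle = {f. (\<lambda>t. f (cis t)) \<in> borel_measurable lebesgue \<and>
                     (\<exists>C. AE t in lebesgue. cmod (f (cis t)) \<le> C)}"

definition fourier_coeff :: "(complex \<Rightarrow> complex) \<Rightarrow> int \<Rightarrow> complex" where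
  "fourier_coeff f n =
     (LINT t:{0..2*pi}|lebesgue. f (cis t) * cis (- (of_int n * t))) / of_real (2*pi)"

definition Hinf_circle :: "(complex \<Rightarrow> complex) set" where
  "Hinf_circle = {f \<in> Linf_circle. \<forall>n<0. fourier_coeff f n = 0}"

definition Gamma_kernel ::
  "(complex \<Rightarrow> complex) \<Rightarrow> 'q::finite tree \<Rightarrow> 'q tree \<Rightarrow> complex" where
  "Gamma_kernel f s t =
     of_real (real CARD('q) powr (- real (tree_dist s t) / 2))
     * fourier_coeff f (int (tree_level s) - int (tree_level t))
     * indicator comparable_pairs (s, t)"

definition Gamma_op ::
  "(complex \<Rightarrow> complex) \<Rightarrow> 'q::finite tree ell2 \<Rightarrow> 'q tree ell2" where
  "Gamma_op f = operator_of_kernel (Gamma_kernel f)"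

end

theory Submission
  imports Defs "HOL-Library.Sublist"
begin

text \<open>
  Let \<open>V\<close> be the isometry on \<open>\<ell>\<^sup>2\<close> of the tree that spreads the mass at a vertex evenly over its
  children: it sends the unit mass at \<open>t\<close> to \<open>1 / sqrt q\<close> times the sum of the unit masses at the
  children of \<open>t\<close>. The kernel of \<open>\<Gamma>[f]\<close> is the one that the Toeplitz operator of \<open>f\<close> has with \<open>V\<close> in
  place of the unilateral shift: the coefficient of index \<open>n \<ge> 0\<close> multiplies the power \<open>n\<close> of \<open>V\<close>, and
  that of index \<open>-n < 0\<close> the power \<open>n\<close> of its adjoint. As the adjoint of \<open>V\<close> has an infinite
  dimensional kernel, \<open>V\<close> contains infinitely many copies of the shift. A defect of multiplicativity is
  then repeated infinitely often and cannot be compact unless it vanishes; and for Toeplitz operators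
  it vanishes only if \<open>f\<close> or \<open>g\<close> is analytic, by a theorem of Brown and Halmos. The proof makes each
  part of this explicit on kernels. Below, \<open>F n\<close> and \<open>G n\<close> stand for the Fourier coefficients of
  \<open>\<phi> = cnj f\<close> and of \<open>g\<close>.

  Boundedness. Restrict \<open>a\<close> to the vertices of an infinite ray from the root, with weight \<open>sqrt q ^ k\<close>
  at level \<open>k\<close>. Averaging over all rays preserves the squared norm, and the average of the Toeplitz
  forms of \<open>f\<close> along the rays is the form of \<open>\<Gamma>[f]\<close>. So the bound by the supremum norm of \<open>f\<close> carries
  over from Toeplitz forms (\<open>Gamma_form_bound\<close>), and a kernel with a bounded form represents an
  operator (\<open>bounded_kernel_represented\<close>).

  Sufficiency. If \<open>g\<close> is analytic, only descendants \<open>u\<close> of \<open>t\<close> contribute to the entry at \<open>(s, t)\<close> of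
  the product, which is the sum over \<open>u\<close> of \<open>\<Gamma>[\<phi>](s, u) \<Gamma>[g](u, t)\<close>. Summed over one level, the number
  of such \<open>u\<close> cancels the powers of \<open>q\<close> (\<open>sum_Gamma_kernel_over_level\<close>), and what is left is the
  convolution of \<open>F\<close> and \<open>G\<close>. It gives the coefficients of \<open>\<phi> g\<close>, because the Fourier series of a
  bounded function converges in mean square (\<open>fourier_coeff_product_has_sum\<close>). The case of analytic
  \<open>f\<close> follows by passing to adjoints.

  Necessity. Let \<open>s\<close> and \<open>t\<close> lie in different branches below a vertex at level \<open>c\<close>, at distances
  \<open>a, b \<ge> 1\<close> from it. Then \<open>\<Gamma>[\<phi> g](s, t) = 0\<close>, and the only vertices comparable with both are their
  \<open>c + 1\<close> common ancestors. So the entry at \<open>(s, t)\<close> of the difference is, up to the factor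
  \<open>1 / sqrt q ^ (a + b)\<close>, the finite sum \<open>M c a b\<close> of \<open>F (a + i) G (- b - i) / q ^ i\<close> over \<open>i \<le> c\<close>
  (\<open>Gamma_product_kernel_branching\<close>). The entries of a compact operator tend to \<open>0\<close> as the row goes
  to infinity (\<open>compact_operator_ell2_kernel_vanishes\<close>), so \<open>M c a b\<close> tends to \<open>0\<close> as \<open>c\<close> grows.
  Since \<open>M (c + 1) a b = F a G (- b) + M c (a + 1) (b + 1) / q\<close>, all the products \<open>F a G (- b)\<close> with
  \<open>a, b \<ge> 1\<close> are \<open>0\<close>. Hence \<open>F\<close> vanishes at all positive indices, which makes \<open>f\<close> analytic, or \<open>G\<close>
  vanishes at all negative ones.
\<close>

section \<open>Bounded operators and their kernels\<close>

lemmas ell2_coord_simps [simp] =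
  zero_ell2.rep_eq plus_ell2.rep_eq minus_ell2.rep_eq uminus_ell2.rep_eq
  scaleR_ell2.rep_eq ell2_scale.rep_eq ell2_delta.rep_eq

lemma ell2_eqI: "(\<And>s. ell2_coord x s = ell2_coord y s) \<Longrightarrow> x = y"
  by (metis ell2_coord_inject ext)

lemma ell2_coord_sum [simp]: "ell2_coord (\<Sum>i\<in>I. v i) s = (\<Sum>i\<in>I. ell2_coord (v i) s)"
  by (induction I rule: infinite_finite_induct) auto

lemma has_sum_norm_ell2:
  fixes x :: "'a ell2"
  shows "((\<lambda>s. (cmod (ell2_coord x s))\<^sup>2) has_sum (norm x)\<^sup>2) UNIV"
proof -
  have sm: "(\<lambda>s. (cmod (ell2_coord x s))\<^sup>2) summable_on UNIV"
    using ell2_coord[of x] by simp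
  have "(norm x)\<^sup>2 = Re (\<Sum>\<^sub>\<infinity>s. ell2_coord x s * cnj (ell2_coord x s))"
    by (simp add: power2_norm_eq_inner inner_ell2_def ell2_cinner.rep_eq)
  also have "\<dots> = (\<Sum>\<^sub>\<infinity>s. Re (ell2_coord x s * cnj (ell2_coord x s)))"
    by (rule infsum_Re[symmetric]) (rule summable_ell2_mult[OF sm sm])
  also have "\<dots> = (\<Sum>\<^sub>\<infinity>s. (cmod (ell2_coord x s))\<^sup>2)"
    by (simp add: cmod_power2 flip: power2_eq_square)
  finally show ?thesis
    using has_sum_infsum[OF sm] by simp
qed

lemma norm_ell2_coord_le: "cmod (ell2_coord x s) \<le> norm x"
proof -
  have "(\<Sum>s\<in>{s}. (cmod (ell2_coord x s))\<^sup>2) \<le> (norm x)\<^sup>2"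
    by (rule finite_sum_le_has_sum[OF has_sum_norm_ell2]) auto
  then have "(cmod (ell2_coord x s))\<^sup>2 \<le> (norm x)\<^sup>2"
    by simp
  then show ?thesis
    by (rule power2_le_imp_le) simp
qed

lemma bounded_linear_ell2_coord: "bounded_linear (\<lambda>x. ell2_coord x s)"
  by (rule bounded_linear_intro[where K = 1])
     (auto simp: norm_ell2_coord_le scaleR_conv_of_real)

lemma ell2_cinner_delta: "ell2_cinner x (ell2_delta s) = ell2_coord x s"
proof -
  have "ell2_cinner x (ell2_delta s) =
      (\<Sum>\<^sub>\<infinity>y\<in>{s}. ell2_coord x y * cnj (ell2_coord (ell2_delta s) y))"
    unfolding ell2_cinner.rep_eq by (rule infsum_cong_neutral) auto
  then show ?thesis by simp
qed

lemma ell2_kernel_eq: "ell2_kernel A s t = ell2_coord (A (ell2_delta t)) s"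
  by (simp add: ell2_kernel_def ell2_cinner_delta)

text \<open>The squared distance of \<open>x\<close> to its finite truncations is a tail of the convergent series for
  \<open>(norm x)\<^sup>2\<close>. This density statement is why a bounded operator is determined by its kernel.\<close>

lemma has_sum_ell2_delta:
  fixes x :: "'a ell2"
  shows "((\<lambda>t. ell2_scale (ell2_coord x t) (ell2_delta t)) has_sum x) UNIV"
proof -
  let ?p = "\<lambda>F. \<Sum>t\<in>F. ell2_scale (ell2_coord x t) (ell2_delta t)"
  let ?n = "\<lambda>s. (cmod (ell2_coord x s))\<^sup>2"
  have dist: "(norm (?p F - x))\<^sup>2 = (norm x)\<^sup>2 - sum ?n F" if "finite F" for F
  proof -
    have coord: "ell2_coord (?p F - x) s = (if s \<in> F then 0 else - ell2_coord x s)" for s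
      using that by (simp add: if_distrib cong: if_cong)
    have "((\<lambda>s. if s \<in> F then - ?n s else 0) has_sum (- sum ?n F)) UNIV"
      by (rule has_sum_finite_neutralI[of F]) (use that in \<open>auto simp: sum_negf\<close>)
    from has_sum_add[OF has_sum_norm_ell2[of x] this]
    have "((\<lambda>s. ?n s + (if s \<in> F then - ?n s else 0)) has_sum ((norm x)\<^sup>2 - sum ?n F)) UNIV"
      by simp
    moreover have "(\<lambda>s. ?n s + (if s \<in> F then - ?n s else 0)) =
        (\<lambda>s. (cmod (ell2_coord (?p F - x) s))\<^sup>2)"
      unfolding coord by auto
    ultimately show ?thesis
      using has_sum_norm_ell2[of "?p F - x"] has_sum_unique by fastforce
  qed
  have "((\<lambda>F. (norm x)\<^sup>2 - sum ?n F) \<longlongrightarrow> (norm x)\<^sup>2 - (norm x)\<^sup>2) (finite_subsets_at_top UNIV)"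
    by (intro tendsto_diff tendsto_const) (use has_sum_norm_ell2[of x] in \<open>simp add: has_sum_def\<close>)
  then have "((\<lambda>F. (norm (?p F - x))\<^sup>2) \<longlongrightarrow> 0) (finite_subsets_at_top UNIV)"
    by (rule Lim_transform_eventually[THEN tendsto_eq_rhs])
       (auto intro!: eventually_finite_subsets_at_top_weakI simp: dist)
  then have "((\<lambda>F. sqrt ((norm (?p F - x))\<^sup>2)) \<longlongrightarrow> sqrt 0) (finite_subsets_at_top UNIV)"
    by (rule tendsto_real_sqrt)
  then have "((\<lambda>F. norm (?p F - x)) \<longlongrightarrow> 0) (finite_subsets_at_top UNIV)"
    by simp
  then show ?thesis
    unfolding has_sum_def by (metis LIM_zero_cancel tendsto_norm_zero_cancel)
qed

lemma bounded_clinear_ell2_kernel_has_sum: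
  assumes "bounded_clinear_ell2 A"
  shows "((\<lambda>t. ell2_kernel A s t * ell2_coord x t) has_sum ell2_coord (A x) s) UNIV"
proof -
  have lin: "bounded_linear (\<lambda>x. ell2_coord (A x) s)"
    using assms bounded_linear_compose[OF bounded_linear_ell2_coord[of s], of A]
    by (simp add: bounded_clinear_ell2_def)
  have "((\<lambda>t. ell2_coord (A (ell2_scale (ell2_coord x t) (ell2_delta t))) s)
      has_sum ell2_coord (A x) s) UNIV"
    by (rule has_sum_bounded_linear[OF lin has_sum_ell2_delta])
  then show ?thesis
    using assms by (simp add: bounded_clinear_ell2_def ell2_kernel_eq mult.commute)
qed

lemma bounded_clinear_ell2_eqI:
  assumes "bounded_clinear_ell2 A" "bounded_clinear_ell2 B" "ell2_kernel A = ell2_kernel B"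
  shows "A = B"
proof (intro ext ell2_eqI)
  show "ell2_coord (A x) s = ell2_coord (B x) s" for x s
    using bounded_clinear_ell2_kernel_has_sum[OF assms(1), of s x]
      bounded_clinear_ell2_kernel_has_sum[OF assms(2), of s x] assms(3)
    by (simp add: has_sum_unique)
qed

lemma operator_of_kernel_eqI:
  assumes "bounded_clinear_ell2 A" "ell2_kernel A = K"
  shows "operator_of_kernel K = A"
  unfolding operator_of_kernel_def
  by (rule the_equality) (use assms bounded_clinear_ell2_eqI in auto)

text \<open>Bounding the form by squares, rather than by a product of norms, is convenient because such
  bounds can be averaged. Testing the form on \<open>b = y / C\<close>, where \<open>y = K a\<close> is the vector to be
  estimated, recovers the operator norm bound \<open>C\<close>.\<close>

lemma finite_matrix_norm_bound:
  fixes K :: "'a \<Rightarrow> 'a \<Rightarrow> complex"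
  assumes "C > 0" "finite G" "finite F"
    and bound: "\<And>F a b. finite F \<Longrightarrow>
        cmod (\<Sum>s\<in>F. \<Sum>t\<in>F. cnj (b s) * K s t * a t)
            \<le> C / 2 * ((\<Sum>s\<in>F. (cmod (a s))\<^sup>2) + (\<Sum>s\<in>F. (cmod (b s))\<^sup>2))"
  shows "(\<Sum>s\<in>F. (cmod (\<Sum>t\<in>G. K s t * a t))\<^sup>2) \<le> C\<^sup>2 * (\<Sum>t\<in>G. (cmod (a t))\<^sup>2)"
proof -
  define y where "y s = (\<Sum>t\<in>G. K s t * a t)" for s
  define a' where "a' t = (if t \<in> G then a t else 0)" for t
  define b' where "b' s = (if s \<in> F then y s / of_real C else 0)" for s
  define Y where "Y = (\<Sum>s\<in>F. (cmod (y s))\<^sup>2)"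
  have fin: "finite (F \<union> G)"
    using assms by simp
  have "(\<Sum>s\<in>F \<union> G. \<Sum>t\<in>F \<union> G. cnj (b' s) * K s t * a' t)
      = (\<Sum>s\<in>F. \<Sum>t\<in>G. cnj (y s) / of_real C * (K s t * a t))"
    by (rule sum.mono_neutral_cong_right[OF fin])
       (auto intro!: sum.neutral sum.mono_neutral_cong_right fin simp: a'_def b'_def)
  also have "\<dots> = (\<Sum>s\<in>F. cnj (y s) / of_real C * y s)"
    by (simp add: y_def sum_distrib_left)
  also have "\<dots> = of_real (Y / C)"
    by (simp add: Y_def sum_divide_distrib mult.commute[of "cnj _"] flip: complex_norm_square)
  moreover have "Y \<ge> 0"
    by (simp add: Y_def sum_nonneg)
  ultimately have eq: "cmod (\<Sum>s\<in>F \<union> G. \<Sum>t\<in>F \<union> G. cnj (b' s) * K s t * a' t) = Y / C"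
    using \<open>C > 0\<close> by (simp only: norm_of_real) simp
  have a: "(\<Sum>s\<in>F \<union> G. (cmod (a' s))\<^sup>2) = (\<Sum>t\<in>G. (cmod (a t))\<^sup>2)"
    by (rule sum.mono_neutral_cong_right[OF fin]) (auto simp: a'_def)
  have "(\<Sum>s\<in>F \<union> G. (cmod (b' s))\<^sup>2) = (\<Sum>s\<in>F. (cmod (y s))\<^sup>2 / C\<^sup>2)"
    by (rule sum.mono_neutral_cong_right[OF fin])
       (auto simp: b'_def norm_divide power_divide)
  then have b: "(\<Sum>s\<in>F \<union> G. (cmod (b' s))\<^sup>2) = Y / C\<^sup>2"
    by (simp add: Y_def sum_divide_distrib)
  have "Y / C \<le> C / 2 * ((\<Sum>t\<in>G. (cmod (a t))\<^sup>2) + Y / C\<^sup>2)"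
    using bound[OF fin, of b' a'] unfolding eq a b .
  then have "Y \<le> C\<^sup>2 * (\<Sum>t\<in>G. (cmod (a t))\<^sup>2)"
    using \<open>C > 0\<close> by (simp add: field_simps power2_eq_square)
  then show ?thesis
    by (simp add: Y_def y_def)
qed

text \<open>A row of \<open>K\<close> is square summable: apply the finite estimate to its own conjugate. Hence the
  series defining the operator converges, and the bound passes to the limit of finite truncations,
  first in the columns and then in the rows.\<close>

lemma bounded_kernel_represented:
  fixes K :: "'a \<Rightarrow> 'a \<Rightarrow> complex"
  assumes "C > 0"
    and bound: "\<And>F a b. finite F \<Longrightarrow>
        cmod (\<Sum>s\<in>F. \<Sum>t\<in>F. cnj (b s) * K s t * a t)
            \<le> C / 2 * ((\<Sum>s\<in>F. (cmod (a s))\<^sup>2) + (\<Sum>s\<in>F. (cmod (b s))\<^sup>2))"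
  shows "\<exists>A. bounded_clinear_ell2 A \<and> ell2_kernel A = K"
proof -
  note fb = finite_matrix_norm_bound[OF \<open>C > 0\<close> _ _ bound]
  have row: "(\<lambda>t. (cmod (K s t))\<^sup>2) summable_on UNIV" for s
  proof (rule nonneg_bdd_above_summable_on)
    have "(\<Sum>t\<in>G. (cmod (K s t))\<^sup>2) \<le> C\<^sup>2" if "finite G" for G
    proof -
      define R where "R = (\<Sum>t\<in>G. (cmod (K s t))\<^sup>2)"
      have "R \<ge> 0"
        by (simp add: R_def sum_nonneg)
      moreover have "(\<Sum>t\<in>G. K s t * cnj (K s t)) = of_real R"
        by (simp add: R_def flip: complex_norm_square)
      ultimately have "cmod (\<Sum>t\<in>G. K s t * cnj (K s t)) = R"
        by (simp only: norm_of_real abs_of_nonneg)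
      then have "R\<^sup>2 \<le> C\<^sup>2 * R"
        using fb[of G "{s}" "\<lambda>t. cnj (K s t)"] that by (simp add: R_def)
      with \<open>R \<ge> 0\<close> have "R \<le> C\<^sup>2"
        by (cases "R = 0") (auto simp: power2_eq_square)
      then show ?thesis
        by (simp add: R_def)
    qed
    then show "bdd_above (sum (\<lambda>t. (cmod (K s t))\<^sup>2) ` {F. F \<subseteq> UNIV \<and> finite F})"
      by (auto intro!: bdd_aboveI2)
  qed auto
  have summ: "(\<lambda>t. K s t * ell2_coord x t) summable_on UNIV" for s and x :: "'a ell2"
    using summable_ell2_mult[OF row, of "\<lambda>t. cnj (ell2_coord x t)" s] ell2_coord[of x] by simp
  define y where "y x s = (\<Sum>\<^sub>\<infinity>t. K s t * ell2_coord x t)" for x :: "'a ell2" and s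
  have hy: "((\<lambda>t. K s t * ell2_coord x t) has_sum y x s) UNIV" for s x
    unfolding y_def by (rule has_sum_infsum[OF summ])
  have ybound: "(\<Sum>s\<in>F. (cmod (y x s))\<^sup>2) \<le> C\<^sup>2 * (norm x)\<^sup>2" if F: "finite F" for F x
  proof (rule tendsto_upperbound)
    show "((\<lambda>G. \<Sum>s\<in>F. (cmod (\<Sum>t\<in>G. K s t * ell2_coord x t))\<^sup>2) \<longlongrightarrow> (\<Sum>s\<in>F. (cmod (y x s))\<^sup>2))
        (finite_subsets_at_top UNIV)"
      by (intro tendsto_sum tendsto_power tendsto_norm) (use hy in \<open>simp add: has_sum_def\<close>)
    have "(\<Sum>s\<in>F. (cmod (\<Sum>t\<in>G. K s t * ell2_coord x t))\<^sup>2) \<le> C\<^sup>2 * (norm x)\<^sup>2" if "finite G" for G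
    proof -
      have "(\<Sum>t\<in>G. (cmod (ell2_coord x t))\<^sup>2) \<le> (norm x)\<^sup>2"
        by (rule finite_sum_le_has_sum[OF has_sum_norm_ell2]) (use that in auto)
      then show ?thesis
        using fb[of G F "ell2_coord x"] that F by (meson mult_left_mono order_trans zero_le_power2)
    qed
    then show "\<forall>\<^sub>F G in finite_subsets_at_top UNIV.
        (\<Sum>s\<in>F. (cmod (\<Sum>t\<in>G. K s t * ell2_coord x t))\<^sup>2) \<le> C\<^sup>2 * (norm x)\<^sup>2"
      by (intro eventually_finite_subsets_at_top_weakI)
  qed simp
  have ysumm: "(\<lambda>s. (cmod (y x s))\<^sup>2) summable_on UNIV" for x
    by (rule nonneg_bdd_above_summable_on) (use ybound in \<open>auto intro!: bdd_aboveI2\<close>)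
  define A where "A x = Abs_ell2 (y x)" for x
  have coord: "ell2_coord (A x) s = y x s" for x s
    using ysumm[of x] by (simp add: A_def Abs_ell2_inverse)
  have "norm (A x) \<le> norm x * C" for x
  proof (rule power2_le_imp_le)
    show "(norm (A x))\<^sup>2 \<le> (norm x * C)\<^sup>2"
      using has_sum_norm_ell2[of "A x"]
      by (rule has_sum_le_finite_sums) (use ybound in \<open>auto simp:
          coord power_mult_distrib mult.commute\<close>)
  qed (use \<open>C > 0\<close> in simp)
  moreover have "A (v + w) = A v + A w" for v w
  proof (rule ell2_eqI)
    fix s
    have "((\<lambda>t. K s t * ell2_coord (v + w) t) has_sum y v s + y w s) UNIV"
      using has_sum_add[OF hy hy, of s v s w] by (simp add: distrib_left)
    then show "ell2_coord (A (v + w)) s = ell2_coord (A v + A w) s"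
      by (simp add: coord has_sum_unique[OF hy])
  qed
  moreover have scale: "A (ell2_scale c v) = ell2_scale c (A v)" for c v
  proof (rule ell2_eqI)
    fix s
    have "((\<lambda>t. K s t * ell2_coord (ell2_scale c v) t) has_sum c * y v s) UNIV"
      using has_sum_cmult_right[OF hy, of c s v] by (simp add: mult.left_commute)
    then show "ell2_coord (A (ell2_scale c v)) s = ell2_coord (ell2_scale c (A v)) s"
      by (simp add: coord has_sum_unique[OF hy])
  qed
  moreover have "A (r *\<^sub>R v) = r *\<^sub>R A v" for r v
  proof -
    have "r *\<^sub>R u = ell2_scale (of_real r) u" for u :: "'a ell2"
      by (intro ell2_eqI) simp
    then show ?thesis by (simp add: scale)
  qed
  ultimately have "bounded_clinear_ell2 A"
    unfolding bounded_clinear_ell2_def by (auto intro!: bounded_linear_intro)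
  moreover have "ell2_kernel A s t = K s t" for s t
  proof -
    have "((\<lambda>u. K s u * ell2_coord (ell2_delta t) u) has_sum K s t) UNIV"
      by (rule has_sum_finite_neutralI[of "{t}"]) auto
    then show ?thesis
      using has_sum_unique[OF hy] by (simp add: ell2_kernel_eq coord)
  qed
  ultimately show ?thesis by blast
qed

text \<open>The columns of \<open>A\<close> lie in a compact set, so up to \<open>e / 2\<close> each of them equals one of finitely
  many square summable vectors, and those are small outside a finite set of rows. The estimate is
  therefore uniform in the column.\<close>

lemma compact_operator_ell2_kernel_vanishes:
  assumes "compact_operator_ell2 A" "e > 0"
  shows "finite {s. \<exists>t. cmod (ell2_kernel A s t) \<ge> e}"
proof -
  have "e / 2 > 0" using assms by simp
  have "compact (closure (A ` cball 0 1))"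
    using assms by (simp add: compact_operator_ell2_def)
  moreover have "closure (A ` cball 0 1) \<subseteq> (\<Union>y\<in>closure (A ` cball 0 1). ball y (e / 2))"
    using \<open>e / 2 > 0\<close> by auto
  ultimately obtain Y where Y: "finite Y" "closure (A ` cball 0 1) \<subseteq> (\<Union>y\<in>Y. ball y (e / 2))"
    using compactE_image[of "closure (A ` cball 0 1)" "closure (A ` cball 0 1)"
        "\<lambda>y. ball y (e / 2)"]
    by (metis open_ball)
  have large: "finite {s. cmod (ell2_coord y s) \<ge> e / 2}" for y :: "'b ell2"
  proof -
    define S where "S = {s. cmod (ell2_coord y s) \<ge> e / 2}"
    have "card F * (e / 2)\<^sup>2 \<le> (norm y)\<^sup>2" if "finite F" "F \<subseteq> S" for F
    proof -
      have "card F * (e / 2)\<^sup>2 = (\<Sum>s\<in>F. (e / 2)\<^sup>2)"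
        by simp
      also have "\<dots> \<le> (\<Sum>s\<in>F. (cmod (ell2_coord y s))\<^sup>2)"
        using that \<open>e > 0\<close> by (intro sum_mono power_mono) (auto simp: S_def)
      also have "\<dots> \<le> (norm y)\<^sup>2"
        by (rule finite_sum_le_has_sum[OF has_sum_norm_ell2]) (use that in auto)
      finally show ?thesis .
    qed
    then have "card F \<le> nat \<lfloor>(norm y)\<^sup>2 / (e / 2)\<^sup>2\<rfloor>" if "finite F" "F \<subseteq> S" for F
      using that \<open>e > 0\<close> by (simp add: le_nat_floor pos_le_divide_eq)
    then show ?thesis
      unfolding S_def[symmetric] by (meson finite_if_finite_subsets_card_bdd)
  qed
  show ?thesis
  proof (rule finite_subset)
    show "{s. \<exists>t. cmod (ell2_kernel A s t) \<ge> e} \<subseteq> (\<Union>y\<in>Y. {s. cmod (ell2_coord y s) \<ge> e / 2})"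
    proof safe
      fix s t assume st: "cmod (ell2_kernel A s t) \<ge> e"
      have "((\<lambda>s. (cmod (ell2_coord (ell2_delta t :: 'a ell2) s))\<^sup>2) has_sum 1) UNIV"
        by (rule has_sum_finite_neutralI[of "{t}"]) auto
      then have "(norm (ell2_delta t :: 'a ell2))\<^sup>2 = 1"
        by (rule has_sum_unique[OF has_sum_norm_ell2])
      then have "norm (ell2_delta t :: 'a ell2) \<le> 1"
        by (simp add: abs_square_eq_1)
      then have "A (ell2_delta t) \<in> closure (A ` cball 0 1)"
        by (intro subsetD[OF closure_subset]) auto
      then obtain y where y: "y \<in> Y" "dist y (A (ell2_delta t)) < e / 2"
        using Y by auto
      have "e \<le> cmod (ell2_coord (A (ell2_delta t)) s)"
        using st by (simp add: ell2_kernel_eq)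
      also have "\<dots> \<le> cmod (ell2_coord y s) + cmod (ell2_coord (y - A (ell2_delta t)) s)"
        by (simp add: norm_minus_commute) (metis norm_minus_commute norm_triangle_sub)
      also have "\<dots> \<le> cmod (ell2_coord y s) + e / 2"
        using y(2) norm_ell2_coord_le[of "y - A (ell2_delta t)" s] by (simp add: dist_norm)
      finally show "s \<in> (\<Union>y\<in>Y. {s. cmod (ell2_coord y s) \<ge> e / 2})"
        using y(1) by force
    qed
  qed (use Y large in auto)
qed

section \<open>The tree as a set of words\<close>

text \<open>Every edge changes the word length by exactly one. This is the lower bound for distances.\<close>

lemma tree_edges_pow_length:
  "(s, t) \<in> tree_edges ^^ n \<Longrightarrow> \<bar>int (length s) - int (length t)\<bar> \<le> int n"
proof (induction n arbitrary: t)
  case (Suc n)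
  then obtain u where "(s, u) \<in> tree_edges ^^ n" "(u, t) \<in> tree_edges" by auto
  with Suc.IH[of u] show ?case by (auto simp: tree_edges_def)
qed auto

lemma sym_tree_edges: "sym tree_edges"
  by (auto simp: sym_def tree_edges_def)

lemma tree_edges_pow_prefix: "(s, s @ v) \<in> tree_edges ^^ length v"
proof (induction v rule: rev_induct)
  case (snoc i v)
  have "(s @ v, s @ v @ [i]) \<in> tree_edges"
    by (auto simp: tree_edges_def)
  with snoc show ?case by auto
qed auto

lemma tree_edges_pow_sym: "(s, t) \<in> tree_edges ^^ n \<Longrightarrow> (t, s) \<in> tree_edges ^^ n"
proof (induction n arbitrary: t)
  case (Suc n)
  then obtain u where "(s, u) \<in> tree_edges ^^ n" "(u, t) \<in> tree_edges" by auto
  with Suc.IH[of u] show ?case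
    using sym_tree_edges by (meson relpow_Suc_I2 symD)
qed auto

lemma tree_dist_sym: "tree_dist s t = tree_dist t s"
  unfolding tree_dist_def by (metis tree_edges_pow_sym)

lemma tree_dist_path: "(s, t) \<in> tree_edges ^^ tree_dist s t"
proof -
  have "(s, []) \<in> tree_edges ^^ length s" "([], t) \<in> tree_edges ^^ length t"
    using tree_edges_pow_prefix[of "[]"] by (auto intro: tree_edges_pow_sym)
  then have "(s, t) \<in> tree_edges ^^ (length s + length t)"
    by (auto simp: relpow_add)
  then show ?thesis
    unfolding tree_dist_def by (rule LeastI)
qed

lemma tree_dist_prefix:
  assumes "prefix s t"
  shows "tree_dist s t = length t - length s"
proof (rule antisym)
  show "tree_dist s t \<le> length t - length s"
    using assms tree_edges_pow_prefix[of s] unfolding tree_dist_def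
    by (auto elim!: prefixE intro!: Least_le)
  show "length t - length s \<le> tree_dist s t"
    using tree_edges_pow_length[OF tree_dist_path[of s t]] by simp
qed

lemma tree_level_eq [simp]: "tree_level s = length s"
  by (simp add: tree_level_def tree_dist_prefix)

text \<open>The vertex number \<open>k\<close> of a geodesic ray has level \<open>k\<close>, so each step of the ray is an edge that
  leads away from the root, that is, from a word to one of its children.\<close>

lemma root_geodesic_ray_prefix:
  assumes "root_geodesic_ray r" "m \<le> n"
  shows "prefix (r m) (r n)"
proof -
  have len: "length (r k) = k" for k
  proof -
    have "r 0 = []" "int (tree_dist (r 0) (r k)) = \<bar>int 0 - int k\<bar>"
      using assms(1) unfolding root_geodesic_ray_def by blast+
    then show ?thesis
      by (simp add: tree_dist_prefix)
  qed
  have step: "prefix (r k) (r (Suc k))" for k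
  proof -
    have "int (tree_dist (r k) (r (Suc k))) = 1"
      using assms(1) by (simp add: root_geodesic_ray_def)
    then have "(r k, r (Suc k)) \<in> tree_edges"
      using tree_dist_path[of "r k" "r (Suc k)"] by simp
    then show ?thesis
      using len[of k] len[of "Suc k"] by (auto simp: tree_edges_def)
  qed
  show ?thesis
    using assms(2) by (induction n rule: dec_induct) (use step prefix_order.trans in blast)+
qed

text \<open>Conversely to the previous lemma, any word can be prolonged to a geodesic ray, by repeating
  some letter.\<close>

lemma tree_le_iff_prefix: "tree_le s t \<longleftrightarrow> prefix s t"
proof
  assume "tree_le s t"
  then obtain r m n where r: "root_geodesic_ray r" "s = r m" "t = r n" "length s \<le> length t"
    by (auto simp: tree_le_def)
  show "prefix s t"
  proof (cases "m \<le> n")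
    case True
    then show ?thesis using root_geodesic_ray_prefix r by blast
  next
    case False
    then have "prefix t s" using root_geodesic_ray_prefix[of r n m] r by simp
    with r(4) show ?thesis by (metis prefix_length_prefix prefix_order.refl)
  qed
next
  assume pre: "prefix s t"
  define r where "r n = take n (t @ replicate n undefined)" for n
  have len: "length (r n) = n" for n
    by (simp add: r_def)
  have mono: "prefix (r m) (r n)" if "m \<le> n" for m n
  proof -
    have "r m = take m (r n)"
    proof -
      have "take m (t @ replicate n undefined) = take m (t @ replicate m undefined)"
        using that by (auto simp: min_def)
      then show ?thesis using that by (simp add: r_def min_def)
    qed
    then show ?thesis by (simp add: take_is_prefix)
  qed
  have "int (tree_dist (r m) (r n)) = \<bar>int m - int n\<bar>" for m n
    using tree_dist_prefix[OF mono, of m n] tree_dist_prefix[OF mono, of n m]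
    by (cases "m \<le> n") (auto simp: len tree_dist_sym[of "r m" "r n"])
  then have "root_geodesic_ray r"
    by (simp add: root_geodesic_ray_def r_def)
  moreover have "r (length u) = u" if "prefix u t" for u
    using that by (auto simp: r_def elim: prefixE)
  then have "s \<in> range r" "t \<in> range r"
    using pre by (metis rangeI, metis rangeI prefix_order.refl)
  ultimately show "tree_le s t"
    unfolding tree_le_def using pre prefix_length_le by auto
qed

lemma comparable_pairs_iff: "(s, t) \<in> comparable_pairs \<longleftrightarrow> prefix s t \<or> prefix t s"
  by (simp add: comparable_pairs_def tree_le_iff_prefix)

abbreviation words :: "nat \<Rightarrow> 'q::finite list set" where
  "words n \<equiv> {w. length w = n}"

lemma finite_words [simp]: "finite (words n :: 'q::finite list set)"
  using finite_lists_length_eq[of "UNIV :: 'q set" n] by simp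

lemma card_words_extending:
  assumes "length s \<le> n"
  shows "card {w :: 'q::finite list. length w = n \<and> prefix s w} = CARD('q) ^ (n - length s)"
proof -
  have "{w. length w = n \<and> prefix s w} = (\<lambda>v. s @ v) ` {v. length v = n - length s}"
    using assms by (auto elim!: prefixE)
  then have "card {w. length w = n \<and> prefix s w} = card {v :: 'q list. length v = n - length s}"
    by (simp add: card_image inj_on_def)
  then show ?thesis
    using card_lists_length_eq[of "UNIV :: 'q set"] by simp
qed

lemma powr_minus_half_of_nat:
  assumes "x > (0 :: real)"
  shows "x powr (- real n / 2) = inverse (sqrt x ^ n)"
proof -
  have "sqrt x ^ n = (x powr (1 / 2)) powr real n"
    using assms by (simp add: powr_half_sqrt powr_realpow)
  also have "\<dots> = x powr (real n / 2)"
    by (simp only: powr_powr times_divide_eq_left mult_1)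
  finally show ?thesis
    using powr_minus[of x "real n / 2"] by (simp only: minus_divide_left)
qed

lemma Gamma_kernel_comparable:
  fixes s t :: "'q::finite list"
  assumes "prefix s t \<or> prefix t s"
  shows "Gamma_kernel f s t =
    fourier_coeff f (int (length s) - int (length t))
        / of_real (sqrt (real CARD('q))) ^ tree_dist s t"
proof -
  have "indicator comparable_pairs (s, t) = (1 :: complex)"
    using assms by (intro indicator_eq_1_iff[THEN iffD2]) (simp only: comparable_pairs_iff)
  moreover have "real CARD('q) > 0"
    by simp
  ultimately show ?thesis
    unfolding Gamma_kernel_def tree_level_eq
    by (simp only: powr_minus_half_of_nat of_real_inverse of_real_power
      divide_inverse[of "fourier_coeff _ _"] mult_1_right mult_1_left mult.commute)
qed

lemma Gamma_kernel_incomparable: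
  assumes "\<not> prefix s t" "\<not> prefix t s"
  shows "Gamma_kernel f s t = 0"
  using assms by (simp add: Gamma_kernel_def comparable_pairs_iff)

section \<open>Fourier series of bounded functions\<close>

abbreviation circle_measure :: "real measure" where
  "circle_measure \<equiv> lebesgue_on {0..2*pi}"

definition mean :: "(real \<Rightarrow> 'a::{banach, second_countable_topology}) \<Rightarrow> 'a" where
  "mean u = (LINT t|circle_measure. u t) /\<^sub>R (2*pi)"

text \<open>All integrals over the circle are taken over the parameter interval. Essentially bounded
  functions form an algebra closed under conjugation, so all products below are integrable.\<close>

definition ess_bounded :: "(real \<Rightarrow> complex) \<Rightarrow> bool" where
  "ess_bounded u \<longleftrightarrow>
     u \<in> borel_measurable circle_measure \<and> (\<exists>C. AE t in circle_measure. cmod (u t) \<le> C)"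

abbreviation character :: "int \<Rightarrow> real \<Rightarrow> complex" where
  "character k t \<equiv> cis (of_int k * t)"

lemma finite_circle_measure: "finite_measure circle_measure"
  by (rule finite_measure_lebesgue_on) simp

lemma measure_circle: "measure circle_measure {0..2*pi} = 2 * pi"
  by (simp add: measure_restrict_space)

lemma mean_const [simp]: "mean (\<lambda>t. c) = c"
  by (simp add: mean_def measure_circle)

lemma char_add: "character k t * character l t = character (k + l) t"
  by (simp add: cis_mult distrib_right)

lemma ess_bounded_integrable: "ess_bounded u \<Longrightarrow> integrable circle_measure u"
  using finite_measure.integrable_const_bound[OF finite_circle_measure]
  by (auto simp: ess_bounded_def)

lemma ess_boundedE:
  assumes "ess_bounded u"
  obtains C where "C > 0" "AE t in circle_measure. cmod (u t) \<le> C"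
proof -
  from assms obtain C where "AE t in circle_measure. cmod (u t) \<le> C"
    by (auto simp: ess_bounded_def)
  then have "AE t in circle_measure. cmod (u t) \<le> max C 1"
    by (auto elim!: eventually_mono)
  then show thesis by (rule that[rotated]) simp
qed

lemma continuous_on_ess_bounded:
  assumes "continuous_on {0..2*pi} u"
  shows "ess_bounded u"
proof -
  have "compact (u ` {0..2*pi})"
    by (rule compact_continuous_image[OF assms]) simp
  then obtain C where "\<forall>t\<in>{0..2*pi}. cmod (u t) \<le> C"
    by (metis bounded_iff compact_imp_bounded imageI)
  moreover have "u \<in> borel_measurable circle_measure"
    using assms by (intro continuous_imp_measurable_on_sets_lebesgue) auto
  ultimately show ?thesis
    unfolding ess_bounded_def by (auto intro!: AE_I2 exI[of _ C])
qed

lemma ess_bounded_const [simp]: "ess_bounded (\<lambda>t. c)"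
  by (intro continuous_on_ess_bounded continuous_intros)

lemma ess_bounded_char [simp]: "ess_bounded (\<lambda>t. character k t)"
  by (intro continuous_on_ess_bounded continuous_intros)

lemma ess_bounded_add:
  assumes "ess_bounded u" "ess_bounded v"
  shows "ess_bounded (\<lambda>t. u t + v t)"
proof -
  obtain C where "AE t in circle_measure. cmod (u t) \<le> C"
    using assms(1) by (rule ess_boundedE)
  moreover obtain D where "AE t in circle_measure. cmod (v t) \<le> D"
    using assms(2) by (rule ess_boundedE)
  ultimately have "AE t in circle_measure. cmod (u t + v t) \<le> C + D"
    by eventually_elim (meson norm_triangle_le add_mono)
  then show ?thesis
    using assms by (auto simp: ess_bounded_def)
qed

lemma ess_bounded_mult:
  assumes "ess_bounded u" "ess_bounded v"
  shows "ess_bounded (\<lambda>t. u t * v t)"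
proof -
  obtain C where "C > 0" and "AE t in circle_measure. cmod (u t) \<le> C"
    using assms(1) by (rule ess_boundedE)
  obtain D where "AE t in circle_measure. cmod (v t) \<le> D"
    using assms(2) by (rule ess_boundedE)
  with \<open>AE t in circle_measure. cmod (u t) \<le> C\<close>
  have "AE t in circle_measure. cmod (u t * v t) \<le> C * D"
  proof eventually_elim
    case (elim t)
    then show ?case
      using \<open>C > 0\<close> unfolding norm_mult by (intro mult_mono) auto
  qed
  then show ?thesis
    using assms by (auto simp: ess_bounded_def)
qed

lemma ess_bounded_cnj:
  assumes "ess_bounded u"
  shows "ess_bounded (\<lambda>t. cnj (u t))"
  using assms by (auto simp: ess_bounded_def intro:
      borel_measurable_continuous_onI[THEN measurable_compose[rotated]] continuous_intros)

lemma ess_bounded_diff: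
  assumes "ess_bounded u" "ess_bounded v"
  shows "ess_bounded (\<lambda>t. u t - v t)"
  using ess_bounded_add[OF assms(1) ess_bounded_mult[OF ess_bounded_const[of "-1"] assms(2)]]
      by simp

lemma ess_bounded_sum:
  "(\<And>i. i \<in> I \<Longrightarrow> ess_bounded (u i)) \<Longrightarrow> ess_bounded (\<lambda>t. \<Sum>i\<in>I. u i t)"
  by (induction I rule: infinite_finite_induct) (auto intro: ess_bounded_add)

lemmas ess_bounded_intros = ess_bounded_const ess_bounded_char ess_bounded_add ess_bounded_diff
  ess_bounded_mult ess_bounded_cnj ess_bounded_sum

lemma mean_add: "ess_bounded u \<Longrightarrow> ess_bounded v \<Longrightarrow> mean (\<lambda>t. u t + v t) = mean u + mean v"
  by (simp add: mean_def ess_bounded_integrable scaleR_add_right)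

lemma mean_diff: "ess_bounded u \<Longrightarrow> ess_bounded v \<Longrightarrow> mean (\<lambda>t. u t - v t) = mean u - mean v"
  by (simp add: mean_def ess_bounded_integrable scaleR_diff_right)

lemma mean_cmult: "mean (\<lambda>t. c * u t) = (c :: complex) * mean u"
  by (simp add: mean_def)

lemma mean_cnj: "mean (\<lambda>t. cnj (u t)) = cnj (mean u)"
  by (simp add: mean_def)

lemma mean_sum:
  "(\<And>i. i \<in> I \<Longrightarrow> ess_bounded (u i)) \<Longrightarrow> mean (\<lambda>t. \<Sum>i\<in>I. u i t) = (\<Sum>i\<in>I. mean (u i))"
  by (induction I rule: infinite_finite_induct) (auto simp: mean_add ess_bounded_sum)

lemma norm_mean_le:
  fixes u :: "real \<Rightarrow> complex"
  assumes "ess_bounded u" "integrable circle_measure g" "AE t in circle_measure. cmod (u t) \<le> g t"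
  shows "cmod (mean u) \<le> mean g"
proof -
  have "cmod (LINT t|circle_measure. u t) \<le> (LINT t|circle_measure. g t)"
    using assms ess_bounded_integrable
    by (intro order_trans[OF integral_norm_bound] integral_mono_AE integrable_norm) auto
  then show ?thesis
    by (simp add: mean_def divide_right_mono)
qed

lemma mean_char: "mean (\<lambda>t. character k t) = (if k = 0 then 1 else 0)"
proof (cases "k = 0")
  case False
  let ?F = "\<lambda>t. character k t / (\<i> * of_int k)"
  have deriv: "(?F has_vector_derivative character k t) (at t within {0..2*pi})" for t
  proof -
    have "((\<lambda>t. exp (\<i> * of_int k * of_real t) / (\<i> * of_int k)) has_vector_derivative
        exp (\<i> * of_int k * of_real t)) (at t within {0..2*pi})"
      using False
      by (auto intro!: derivative_eq_intros has_vector_derivative_real_field)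
    moreover have "exp (\<i> * of_int k * of_real s) = character k s" for s
      by (simp add: cis_conv_exp mult.assoc)
    ultimately show ?thesis by simp
  qed
  have "((\<lambda>t. character k t) has_integral ?F (2*pi) - ?F 0) {0..2*pi}"
    by (rule fundamental_theorem_of_calculus) (use deriv in auto)
  moreover have "character k (2*pi) = 1"
    using cis_multiple_2pi[of "of_int k"] by (simp add: mult.commute mult.left_commute)
  ultimately have "((\<lambda>t. character k t) has_integral 0) {0..2*pi}"
    by simp
  moreover have "((\<lambda>t. character k t) has_integral
      (LINT t|circle_measure. character k t)) {0..2*pi}"
    by (rule has_integral_integral_lebesgue_on[OF ess_bounded_integrable]) auto
  ultimately show ?thesis
    using False by (simp add: mean_def has_integral_unique)
qed simp

definition msq :: "(real \<Rightarrow> complex) \<Rightarrow> real" where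
  "msq u = mean (\<lambda>t. (cmod (u t))\<^sup>2)"

lemma integrable_sq:
  assumes "ess_bounded u"
  shows "integrable circle_measure (\<lambda>t. (cmod (u t))\<^sup>2)"
proof -
  have "integrable circle_measure (\<lambda>t. Re (u t * cnj (u t)))"
    using ess_bounded_integrable[OF ess_bounded_mult[OF assms ess_bounded_cnj[OF assms]]]
    by (rule integrable_Re)
  then show ?thesis
    by (simp add: cmod_power2 flip: power2_eq_square)
qed

lemma msq_nonneg: "msq u \<ge> 0"
  by (simp add: msq_def mean_def)

lemma msq_eq: "complex_of_real (msq u) = mean (\<lambda>t. u t * cnj (u t))"
  unfolding complex_norm_square[symmetric] msq_def mean_def
  by (simp only: integral_complex_of_real) (simp add: scaleR_conv_of_real)

text \<open>The Cauchy--Schwarz inequality in the form of the weighted inequality between arithmetic and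
  geometric means: with \<open>d = 1\<close> it bounds Toeplitz forms, and with \<open>d\<close> small it shows that mean
  square convergence implies convergence of Fourier coefficients of products.\<close>

lemma mean_mult_le:
  assumes "ess_bounded f" "ess_bounded u" "ess_bounded v" "C > 0" "d > 0"
    and C: "AE t in circle_measure. cmod (f t) \<le> C"
  shows "cmod (mean (\<lambda>t. f t * u t * cnj (v t))) \<le> C / 2 * (msq u / d + d * msq v)"
proof -
  note sq = integrable_sq[OF assms(2)] integrable_sq[OF assms(3)]
  have "cmod (mean (\<lambda>t. f t * u t * cnj (v t)))
      \<le> mean (\<lambda>t. C / 2 * ((cmod (u t))\<^sup>2 / d + d * (cmod (v t))\<^sup>2))"
  proof (rule norm_mean_le)
    show "AE t in circle_measure. cmod (f t * u t * cnj (v t))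
        \<le> C / 2 * ((cmod (u t))\<^sup>2 / d + d * (cmod (v t))\<^sup>2)"
      using C
    proof eventually_elim
      case (elim t)
      have "0 \<le> (cmod (u t) - d * cmod (v t))\<^sup>2 / d"
        using \<open>d > 0\<close> by simp
      then have "2 * (cmod (u t) * cmod (v t)) \<le> (cmod (u t))\<^sup>2 / d + d * (cmod (v t))\<^sup>2"
        using \<open>d > 0\<close> by (simp add: field_simps power2_eq_square)
      moreover have "cmod (f t * u t * cnj (v t)) \<le> C * (cmod (u t) * cmod (v t))"
        using elim by (simp add: norm_mult mult.assoc mult_right_mono)
      ultimately show ?case
        using mult_left_mono[of "2 * (cmod (u t) * cmod (v t))"
            "(cmod (u t))\<^sup>2 / d + d * (cmod (v t))\<^sup>2" "C / 2"]
          \<open>C > 0\<close> by linarith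
    qed
  qed (use sq assms in \<open>auto intro!: ess_bounded_intros\<close>)
  also have "\<dots> = C / 2 * (msq u / d + d * msq v)"
    using sq by (simp add: msq_def mean_def algebra_simps)
  finally show ?thesis .
qed

lemma mean_char_pairing:
  "mean (\<lambda>t. character k t * cnj (character l t)) = (if k = l then 1 else 0)"
  using mean_char[of "k - l"] by (simp add: cis_cnj cis_mult left_diff_distrib)

lemma msq_char_sum:
  assumes "finite F"
  shows "msq (\<lambda>t. \<Sum>k\<in>F. c k * character k t) = (\<Sum>k\<in>F. (cmod (c k))\<^sup>2)"
proof -
  have "complex_of_real (msq (\<lambda>t. \<Sum>k\<in>F. c k * character k t))
      = mean (\<lambda>t. \<Sum>k\<in>F. \<Sum>l\<in>F. (c k * cnj (c l)) * (character k t * cnj (character l t)))"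
    unfolding msq_eq by (simp add: sum_product mult_ac)
  also have "\<dots> = (\<Sum>k\<in>F. \<Sum>l\<in>F. (c k * cnj (c l)) * (if k = l then 1 else 0))"
    by (simp add: mean_sum mean_cmult mean_char_pairing ess_bounded_intros)
  also have "\<dots> = (\<Sum>k\<in>F. c k * cnj (c k))"
    using assms by (simp add: if_distrib cong: if_cong)
  also have "\<dots> = complex_of_real (\<Sum>k\<in>F. (cmod (c k))\<^sup>2)"
    by (simp flip: complex_norm_square)
  finally show ?thesis
    by (simp only: of_real_eq_iff)
qed

text \<open>The form is the mean of \<open>f X (cnj Y)\<close>, where \<open>X\<close> and \<open>Y\<close> are the trigonometric polynomials
  with coefficients \<open>x\<close> and \<open>y\<close>.\<close>

lemma toeplitz_form_bound:
  assumes f: "ess_bounded f" "C > 0" "AE t in circle_measure. cmod (f t) \<le> C" and "finite F"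
  shows "cmod (\<Sum>j\<in>F. \<Sum>k\<in>F. cnj (y j) * mean (\<lambda>t. f t * character (k - j) t) * x k)
    \<le> C / 2 * ((\<Sum>k\<in>F. (cmod (x k))\<^sup>2) + (\<Sum>j\<in>F. (cmod (y j))\<^sup>2))"
proof -
  let ?X = "\<lambda>t. \<Sum>k\<in>F. x k * character k t" and ?Y = "\<lambda>t. \<Sum>j\<in>F. y j * character j t"
  have "(\<Sum>j\<in>F. \<Sum>k\<in>F. cnj (y j) * mean (\<lambda>t. f t * character (k - j) t) * x k)
      = (\<Sum>j\<in>F. \<Sum>k\<in>F. mean (\<lambda>t. (cnj (y j) * x k) * (f t * character (k - j) t)))"
    unfolding mean_cmult by (simp add: mult_ac)
  also have "\<dots> = mean (\<lambda>t. \<Sum>j\<in>F. \<Sum>k\<in>F. (cnj (y j) * x k) * (f t * character (k - j) t))"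
    using f by (simp add: mean_sum ess_bounded_intros del: of_int_diff)
  also have "\<dots> = mean (\<lambda>t. f t * ?X t * cnj (?Y t))"
  proof -
    have c: "character (k - j) t = character k t * cnj (character j t)" for j k t
      by (simp add: cis_cnj cis_mult left_diff_distrib)
    have "(\<Sum>j\<in>F. \<Sum>k\<in>F. (cnj (y j) * x k) * (f t * character (k - j) t)) = f t * ?X t * cnj (?Y t)"
        for t
      unfolding c by (subst sum.swap) (simp add: sum_product sum_distrib_left mult_ac)
    then show ?thesis by simp
  qed
  also have "cmod \<dots> \<le> C / 2 * (msq ?X / 1 + 1 * msq ?Y)"
    by (rule mean_mult_le) (use f in \<open>auto intro!: ess_bounded_intros\<close>)
  finally show ?thesis
    using assms by (simp add: msq_char_sum)
qed

text \<open>The remainder of a Fourier sum is orthogonal to the characters involved, so replacing the Fourier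
  coefficients by other ones adds the mean square of a trigonometric polynomial.\<close>

lemma bessel_best_approximation:
  assumes v: "ess_bounded v" and F: "finite F"
  defines "a \<equiv> (\<lambda>k. mean (\<lambda>t. v t * character (- k) t))"
  shows "msq (\<lambda>t. v t - (\<Sum>k\<in>F. a k * character k t)) \<le> msq (\<lambda>t. v t - (\<Sum>k\<in>F. c k * character k t))"
proof -
  define r where "r t = v t - (\<Sum>k\<in>F. a k * character k t)" for t
  define p where "p t = (\<Sum>k\<in>F. (a k - c k) * character k t)" for t
  have r: "ess_bounded r" unfolding r_def by (intro ess_bounded_intros v)
  have p: "ess_bounded p" unfolding p_def by (intro ess_bounded_intros)
  have orth: "mean (\<lambda>t. r t * cnj (character l t)) = 0" if "l \<in> F" for l
  proof -
    have "mean (\<lambda>t. r t * cnj (character l t))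
        = mean (\<lambda>t. v t * cnj (character l t)
            - (\<Sum>k\<in>F. a k * (character k t * cnj (character l t))))"
      unfolding r_def by (simp add: left_diff_distrib sum_distrib_right mult.assoc)
    also have "\<dots> = mean (\<lambda>t. v t * cnj (character l t)) - (\<Sum>k\<in>F. a k * (if k = l then 1 else 0))"
      by (simp add: mean_diff mean_sum mean_cmult mean_char_pairing ess_bounded_intros v)
    also have "(\<Sum>k\<in>F. a k * (if k = l then 1 else 0)) = a l"
      using F that by (simp add: if_distrib cong: if_cong)
    finally show ?thesis
      by (simp add: a_def cis_cnj)
  qed
  have "mean (\<lambda>t. r t * cnj (p t)) = mean (\<lambda>t. \<Sum>k\<in>F. cnj (a k - c k) * (r t * cnj (character k t)))"
    unfolding p_def by (simp add: sum_distrib_left mult_ac)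
  also have "\<dots> = 0"
    using orth by (simp add: mean_sum mean_cmult ess_bounded_intros r)
  finally have rp: "mean (\<lambda>t. r t * cnj (p t)) = 0" .
  then have pr: "mean (\<lambda>t. p t * cnj (r t)) = 0"
    using mean_cnj[of "\<lambda>t. r t * cnj (p t)"] by (simp add: mult.commute)
  have split: "v t - (\<Sum>k\<in>F. c k * character k t) = r t + p t" for t
    by (simp add: r_def p_def left_diff_distrib sum_subtractf)
  have "complex_of_real (msq (\<lambda>t. r t + p t))
      = mean (\<lambda>t. r t * cnj (r t) + p t * cnj (p t) + (r t * cnj (p t) + p t * cnj (r t)))"
    unfolding msq_eq by (simp add: algebra_simps)
  also have "\<dots> = complex_of_real (msq r + msq p)"
    by (simp add: mean_add ess_bounded_intros r p rp pr flip: msq_eq)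
  finally have "msq (\<lambda>t. r t + p t) = msq r + msq p"
    by (simp only: of_real_eq_iff)
  then show ?thesis
    unfolding split r_def[symmetric] using msq_nonneg[of p] by simp
qed

lemma msq_add_le:
  assumes "ess_bounded u" "ess_bounded v"
  shows "msq (\<lambda>t. u t + v t) \<le> 2 * msq u + 2 * msq v"
proof -
  have "(LINT t|circle_measure. (cmod (u t + v t))\<^sup>2)
      \<le> (LINT t|circle_measure. 2 * (cmod (u t))\<^sup>2 + 2 * (cmod (v t))\<^sup>2)"
  proof (rule integral_mono)
    fix t
    have "(cmod (u t + v t))\<^sup>2 \<le> (cmod (u t) + cmod (v t))\<^sup>2"
      by (intro power_mono norm_triangle_ineq) auto
    also have "\<dots> \<le> 2 * (cmod (u t))\<^sup>2 + 2 * (cmod (v t))\<^sup>2"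
      using sum_squares_bound[of "cmod (u t)" "cmod (v t)"] by (simp add: power2_sum)
    finally show "(cmod (u t + v t))\<^sup>2 \<le> 2 * (cmod (u t))\<^sup>2 + 2 * (cmod (v t))\<^sup>2" .
  qed (use assms in \<open>auto intro!: integrable_sq ess_bounded_intros\<close>)
  also have "\<dots>
      = 2 * (LINT t|circle_measure. (cmod (u t))\<^sup>2) + 2 * (LINT t|circle_measure. (cmod (v t))\<^sup>2)"
    using assms by (simp add: integrable_sq)
  finally show ?thesis
    unfolding msq_def mean_def by (simp add: divide_simps)
qed

lemma msq_le_const:
  assumes "ess_bounded u" "\<And>t. t \<in> {0..2*pi} \<Longrightarrow> cmod (u t) \<le> e" "e \<ge> 0"
  shows "msq u \<le> e\<^sup>2"
proof -
  have "(LINT t|circle_measure. (cmod (u t))\<^sup>2) \<le> (LINT t|circle_measure. e\<^sup>2)"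
    using assms by (intro integral_mono integrable_sq power_mono)
      (auto intro: finite_measure.integrable_const[OF finite_circle_measure])
  then have "(LINT t|circle_measure. (cmod (u t))\<^sup>2) \<le> 2 * pi * e\<^sup>2"
    by (simp add: measure_circle)
  then have "(LINT t|circle_measure. (cmod (u t))\<^sup>2) / (2 * pi) \<le> e\<^sup>2"
    by (subst pos_divide_le_eq) (simp_all add: mult.commute)
  then show ?thesis
    by (simp only: msq_def mean_def real_scaleR_def divide_inverse_commute)
qed

text \<open>A measurable function is almost everywhere a limit of continuous functions. These can be cut
  down to the essential bound of \<open>v\<close> and multiplied by bumps that vanish at both ends of the interval
  without changing the limit inside it; dominated convergence then gives mean square convergence.
  Vanishing at the end points makes the approximants continuous on the circle.\<close>

lemma continuous_loop_mean_square_dense: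
  assumes v: "ess_bounded v" and "e > 0"
  obtains h where "continuous_on {0..2*pi} h" "h 0 = 0" "h (2*pi) = 0" "msq (\<lambda>t. v t - h t) < e"
proof -
  obtain C where C: "C > 0" "AE t in circle_measure. cmod (v t) \<le> C"
    using v by (rule ess_boundedE)
  have "v measurable_on {0..2*pi}"
    using v by (simp add: ess_bounded_def measurable_on_iff_borel_measurable)
  then obtain N g where N: "negligible N" and g: "\<And>n. continuous_on UNIV (g n)"
      and lim: "\<And>t. t \<notin> N \<Longrightarrow> (\<lambda>n. g n t) \<longlonglongrightarrow> (if t \<in> {0..2*pi} then v t else 0)"
    unfolding measurable_on_def by metis
  \<comment> \<open>The bump \<open>b n\<close> vanishes at the end points, and the factor \<open>C / max C \<bar>g n t\<bar>\<close> is the radial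
    retraction onto the disc of radius \<open>C\<close>.\<close>
  define b where "b n t = 1 - \<bar>1 - t / pi\<bar> ^ Suc n" for n :: nat and t
  define h where "h n t = (b n t * (C / max C (cmod (g n t)))) *\<^sub>R g n t" for n t
  have cont: "continuous_on {0..2*pi} (h n)" for n
    unfolding h_def b_def
    by (intro continuous_intros continuous_on_subset[OF g]) (use C in \<open>auto simp: max_def\<close>)
  have b: "0 \<le> b n t" "b n t \<le> 1" if "t \<in> {0..2*pi}" for n t
  proof -
    have "\<bar>1 - t / pi\<bar> \<le> 1"
      using that by (auto simp: abs_le_iff field_simps)
    then have "\<bar>1 - t / pi\<bar> ^ Suc n \<le> 1"
      by (intro power_le_one) auto
    then show "0 \<le> b n t" "b n t \<le> 1"
      by (auto simp: b_def)
  qed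
  have hC: "cmod (h n t) \<le> C" if "t \<in> {0..2*pi}" for n t
  proof -
    have "C * cmod (g n t) \<le> C * max C (cmod (g n t))"
      using C by (intro mult_left_mono) auto
    then have "C / max C (cmod (g n t)) * cmod (g n t) \<le> C"
      using C by (simp add: pos_divide_le_eq max.strict_coboundedI1)
    moreover have "0 \<le> C / max C (cmod (g n t)) * cmod (g n t)"
      using C by (simp add: max.coboundedI1)
    ultimately have "b n t * (C / max C (cmod (g n t)) * cmod (g n t)) \<le> 1 * C"
      using b[OF that] by (intro mult_mono) auto
    then show ?thesis
      using b[OF that, of n] C by (simp add: h_def abs_mult max.coboundedI1 mult.assoc)
  qed
  have hlim: "(\<lambda>n. h n t) \<longlonglongrightarrow> v t" if "t \<in> {0..2*pi}" "t \<notin> N \<union> {0, 2*pi}" "cmod (v t) \<le> C" for t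
  proof -
    have gt: "(\<lambda>n. g n t) \<longlonglongrightarrow> v t"
      using lim[of t] that by simp
    have "\<bar>1 - t / pi\<bar> < 1"
      using that by (auto simp: abs_less_iff field_simps)
    then have "(\<lambda>n. \<bar>1 - t / pi\<bar> ^ Suc n) \<longlonglongrightarrow> 0"
      by (intro LIMSEQ_Suc LIMSEQ_power_zero) simp
    then have "(\<lambda>n. b n t) \<longlonglongrightarrow> 1 - 0"
      unfolding b_def by (intro tendsto_diff tendsto_const)
    moreover have "(\<lambda>n. C / max C (cmod (g n t))) \<longlonglongrightarrow> C / max C (cmod (v t))"
      using less_le_trans[OF C(1) max.cobounded1[of C "cmod (v t)"]]
      by (intro tendsto_divide tendsto_max tendsto_const tendsto_norm gt) simp
    ultimately have "(\<lambda>n. h n t) \<longlonglongrightarrow> ((1 - 0) * (C / max C (cmod (v t)))) *\<^sub>R v t"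
      unfolding h_def by (intro tendsto_scaleR tendsto_mult gt)
    then show ?thesis
      using that C by (simp add: max_absorb1)
  qed
  have "AE t in circle_measure. t \<notin> N \<union> {0, 2*pi}"
  proof -
    have "negligible (N \<union> {0, 2*pi})"
      using N by (simp add: negligible_Un)
    then have "AE t in lebesgue. t \<notin> N \<union> {0, 2*pi}"
      by (intro AE_not_in) (simp add: negligible_iff_null_sets)
    then have "AE t in lebesgue. t \<in> {0..2*pi} \<longrightarrow> t \<notin> N \<union> {0, 2*pi}"
      by (rule eventually_mono) simp
    then show ?thesis
      by (subst AE_restrict_space_iff) auto
  qed
  moreover have "AE t in circle_measure. t \<in> {0..2*pi}"
    by (intro AE_I2) simp
  ultimately have ae: "AE t in circle_measure. (\<lambda>n. (cmod (v t - h n t))\<^sup>2) \<longlonglongrightarrow> 0"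
    using C(2)
  proof eventually_elim
    case (elim t)
    then have "(\<lambda>n. (cmod (v t - h n t))\<^sup>2) \<longlonglongrightarrow> (cmod (v t - v t))\<^sup>2"
      by (intro tendsto_intros hlim) auto
    then show ?case by simp
  qed
  have bnd: "AE t in circle_measure. norm ((cmod (v t - h n t))\<^sup>2) \<le> (2 * C)\<^sup>2" for n
    using C(2) \<open>AE t in circle_measure. t \<in> {0..2*pi}\<close>
  proof eventually_elim
    case (elim t)
    then have "cmod (v t - h n t) \<le> 2 * C"
      using norm_triangle_ineq4[of "v t" "h n t"] hC[of t n] by linarith
    then have "(cmod (v t - h n t))\<^sup>2 \<le> (2 * C)\<^sup>2"
      by (rule power_mono) simp
    then show ?case by simp
  qed
  have eb: "ess_bounded (\<lambda>t. v t - h n t)" for n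
    by (intro ess_bounded_intros v continuous_on_ess_bounded cont)
  have "(\<lambda>n. LINT t|circle_measure. (cmod (v t - h n t))\<^sup>2) \<longlonglongrightarrow> (LINT t|circle_measure. 0)"
  proof (rule integral_dominated_convergence[where w = "\<lambda>_. (2 * C)\<^sup>2"])
    show "integrable circle_measure (\<lambda>_. (2 * C)\<^sup>2)"
      by (rule finite_measure.integrable_const[OF finite_circle_measure])
    show "(\<lambda>t. (cmod (v t - h n t))\<^sup>2) \<in> borel_measurable circle_measure" for n
      using integrable_sq[OF eb[of n]] by (rule borel_measurable_integrable)
  qed (use ae bnd in auto)
  then have "(\<lambda>n. msq (\<lambda>t. v t - h n t)) \<longlonglongrightarrow> 0"
    unfolding msq_def mean_def by (auto intro: tendsto_mult_right_zero)
  then have "\<forall>\<^sub>F n in sequentially. msq (\<lambda>t. v t - h n t) < e"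
    by (rule order_tendstoD) fact
  then obtain n where "msq (\<lambda>t. v t - h n t) < e"
    by (auto simp: eventually_sequentially)
  then show thesis
    using cont by (intro that[of "h n"]) (simp_all add: h_def b_def)
qed

text \<open>An inductive presentation, for which closure under products takes two inductions; the
  presentation as finite sums of characters with distinct frequencies is derived from it.\<close>

inductive_set trig_polynomials :: "(real \<Rightarrow> complex) set" where
  monomial: "(\<lambda>t. c * character k t) \<in> trig_polynomials"
| plus: "p \<in> trig_polynomials \<Longrightarrow> r \<in> trig_polynomials \<Longrightarrow> (\<lambda>t. p t + r t) \<in> trig_polynomials"

lemma trig_polynomials_mult:
  assumes "p \<in> trig_polynomials" "r \<in> trig_polynomials"
  shows "(\<lambda>t. p t * r t) \<in> trig_polynomials"
  using assms(1)
proof induction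
  case (monomial c k)
  show ?case using assms(2)
  proof induction
    case (monomial d l)
    have "(\<lambda>t. c * character k t * (d * character l t)) = (\<lambda>t. (c * d) * character (k + l) t)"
      unfolding char_add[symmetric] by (simp add: mult_ac)
    then show ?case
      using trig_polynomials.monomial by metis
  next
    case (plus p r)
    then show ?case
      by (simp add: distrib_left trig_polynomials.plus)
  qed
next
  case (plus p r)
  then show ?case
    by (simp add: distrib_right trig_polynomials.plus)
qed

lemma trig_polynomials_sum:
  assumes "p \<in> trig_polynomials"
  shows "\<exists>F c. finite F \<and> p = (\<lambda>t. \<Sum>k\<in>F. c k * character k t)"
  using assms
proof induction
  case (monomial c k)
  show ?case by (intro exI[of _ "{k}"] exI[of _ "\<lambda>_. c"]) simp
next
  case (plus p r)
  then obtain F c G d where FG: "finite F" "p = (\<lambda>t. \<Sum>k\<in>F. c k * character k t)"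
      "finite G" "r = (\<lambda>t. \<Sum>k\<in>G. d k * character k t)" by auto
  have "(\<Sum>k\<in>F. c k * character k t) = (\<Sum>k\<in>F \<union> G. (if k \<in> F then c k else 0) * character k t)"
    "(\<Sum>k\<in>G. d k * character k t) = (\<Sum>k\<in>F \<union> G. (if k \<in> G then d k else 0) * character k t)" for t
    using FG by (auto intro!: sum.mono_neutral_cong_left)
  then have "(\<lambda>t. p t + r t)
      = (\<lambda>t. \<Sum>k\<in>F \<union> G. ((if k \<in> F then c k else 0) + (if k \<in> G then d k else 0)) * character k t)"
    by (simp add: FG distrib_right sum.distrib)
  then show ?case
    using FG by (intro exI[of _ "F \<union> G"] exI) auto
qed

lemma real_polynomial_on_circle:
  assumes "real_polynomial_function r"
  shows "(\<lambda>t. complex_of_real (r (cis t))) \<in> trig_polynomials"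
  using assms
proof induction
  case (linear f)
  interpret f: bounded_linear f by fact
  have "f (cis t) = cos t * f 1 + sin t * f \<i>" for t
  proof -
    have "cis t = cos t *\<^sub>R 1 + sin t *\<^sub>R \<i>"
      by (simp add: complex_eq_iff)
    then show ?thesis
      by (simp add: f.add f.scaleR)
  qed
  then have "(\<lambda>t. complex_of_real (f (cis t)))
      = (\<lambda>t. Complex (f 1 / 2) (- f \<i> / 2) * character 1 t + Complex (f 1 / 2) (f \<i> / 2)
          * character (- 1) t)"
    by (auto simp: complex_eq_iff)
  then show ?case
    by (simp only: plus monomial)
next
  case (const c)
  show ?case using monomial[of "of_real c" 0] by simp
next
  case (add f g)
  then show ?case by (simp add: plus)
next
  case (mult f g)
  then show ?case by (simp add: trig_polynomials_mult)
qed

lemma polynomial_on_circle: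
  fixes p :: "complex \<Rightarrow> complex"
  assumes "polynomial_function p"
  shows "(\<lambda>t. p (cis t)) \<in> trig_polynomials"
proof -
  have "real_polynomial_function (\<lambda>z. Re (p z))" "real_polynomial_function (\<lambda>z. Im (p z))"
    using assms bounded_linear_Re bounded_linear_Im by (auto simp: polynomial_function_def o_def)
  then have "(\<lambda>t. complex_of_real (Re (p (cis t))) + (\<i> * character 0 t)
      * complex_of_real (Im (p (cis t))))
      \<in> trig_polynomials"
    by (intro plus trig_polynomials_mult monomial real_polynomial_on_circle)
  moreover have "complex_of_real (Re z) + (\<i> * character 0 t) * complex_of_real (Im z) = z" for z t
    by (simp add: complex_eq_iff)
  ultimately show ?thesis by simp
qed

text \<open>The parametrization of the circle by a compact interval is a closed map, so preimages of closed
  sets under the induced function are closed.\<close>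

lemma continuous_on_circle_of_loop:
  fixes h :: "real \<Rightarrow> complex"
  assumes h: "continuous_on {0..2*pi} h" "h 0 = h (2*pi)"
  obtains H where "continuous_on (sphere 0 1) H" "\<And>t. t \<in> {0..2*pi} \<Longrightarrow> H (cis t) = h t"
proof -
  define H where "H z = h (Arg2pi z)" for z
  have H: "H (cis t) = h t" if "t \<in> {0..2*pi}" for t
  proof (cases "t = 2 * pi")
    case True
    then show ?thesis using h Arg2pi_of_real[of 1] by (simp add: H_def)
  next
    case False
    then have "Arg2pi (cis t) = t"
      using that by (intro Arg2pi_unique[of 1]) (auto simp: cis_conv_exp)
    then show ?thesis by (simp add: H_def)
  qed
  have "continuous_on (sphere 0 1) H"
    unfolding continuous_on_closed_invariant
  proof (intro allI impI)
    fix B :: "complex set" assume "closed B"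
    let ?A = "cis ` ({0..2*pi} \<inter> h -` B)"
    have "compact ({0..2*pi} \<inter> h -` B)"
      using continuous_closed_preimage[OF h(1) _ \<open>closed B\<close>]
      by (intro compact_eq_bounded_closed[THEN iffD2] conjI bounded_Int) auto
    then have "closed ?A"
      by (intro compact_imp_closed compact_continuous_image continuous_intros)
    moreover have "?A \<inter> sphere 0 1 = H -` B \<inter> sphere 0 1"
    proof (intro set_eqI iffI)
      fix z assume "z \<in> H -` B \<inter> sphere 0 1"
      then have "z = cis (Arg2pi z)" "Arg2pi z \<in> {0..2*pi}" "h (Arg2pi z) \<in> B"
        using Arg2pi[of z] by (auto simp: H_def cis_conv_exp is_Arg_def)
      moreover from this(1) have "cmod z = 1"
        by (metis norm_cis)
      ultimately show "z \<in> ?A \<inter> sphere 0 1" by auto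
    qed (use H in auto)
    ultimately show "\<exists>A. closed A \<and> A \<inter> sphere 0 1 = H -` B \<inter> sphere 0 1"
      by blast
  qed
  then show thesis using H that by blast
qed

text \<open>By the Stone--Weierstrass theorem on the circle, where real polynomials in the two coordinates
  are trigonometric polynomials.\<close>

lemma trig_polynomials_mean_square_dense:
  assumes v: "ess_bounded v" and "e > 0"
  obtains F c where "finite F" "msq (\<lambda>t. v t - (\<Sum>k\<in>F. c k * character k t)) < e"
proof -
  obtain h where h: "continuous_on {0..2*pi} h" "h 0 = 0" "h (2*pi) = 0"
      "msq (\<lambda>t. v t - h t) < e / 4"
    using continuous_loop_mean_square_dense[OF v, of "e / 4"] \<open>e > 0\<close> by auto
  obtain H where H: "continuous_on (sphere 0 1) H" "\<And>t. t \<in> {0..2*pi} \<Longrightarrow> H (cis t) = h t"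
    using continuous_on_circle_of_loop[OF h(1)] h by auto
  obtain p where p: "polynomial_function p" "\<And>z. z \<in> sphere 0 1 \<Longrightarrow> cmod (H z - p z) < sqrt e / 2"
    using Stone_Weierstrass_polynomial_function[OF compact_sphere H(1), of "sqrt e / 2"] \<open>e > 0\<close>
        by auto
  obtain F c where F: "finite F" "(\<lambda>t. p (cis t)) = (\<lambda>t. \<Sum>k\<in>F. c k * character k t)"
    using trig_polynomials_sum[OF polynomial_on_circle[OF p(1)]] by auto
  have pe: "ess_bounded (\<lambda>t. p (cis t))"
    unfolding F(2) by (intro ess_bounded_intros)
  have he: "ess_bounded h"
    by (rule continuous_on_ess_bounded[OF h(1)])
  have "cmod (h t - p (cis t)) \<le> sqrt e / 2" if "t \<in> {0..2*pi}" for t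
    using p(2)[of "cis t"] H(2)[OF that] by simp
  then have "msq (\<lambda>t. h t - p (cis t)) \<le> (sqrt e / 2)\<^sup>2"
    using \<open>e > 0\<close> by (intro msq_le_const ess_bounded_diff he pe) auto
  moreover have "msq (\<lambda>t. (v t - h t) + (h t - p (cis t)))
      \<le> 2 * msq (\<lambda>t. v t - h t) + 2 * msq (\<lambda>t. h t - p (cis t))"
    by (intro msq_add_le ess_bounded_intros v he pe)
  ultimately have "msq (\<lambda>t. v t - p (cis t)) < e"
    using h(4) \<open>e > 0\<close> by (simp add: power_divide)
  then show thesis
    using F by (intro that[of F c]) (simp_all add: fun_eq_iff)
qed

lemma fourier_series_mean_square:
  assumes v: "ess_bounded v"
  defines "a \<equiv> (\<lambda>k. mean (\<lambda>t. v t * character (- k) t))"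
  shows "((\<lambda>F. msq (\<lambda>t. v t - (\<Sum>k\<in>F. a k * character k t))) \<longlongrightarrow> 0) (finite_subsets_at_top UNIV)"
proof (rule order_tendstoI)
  fix e :: real assume "e > 0"
  then obtain G c where G: "finite G" "msq (\<lambda>t. v t - (\<Sum>k\<in>G. c k * character k t)) < e"
    by (rule trig_polynomials_mean_square_dense[OF v])
  have "msq (\<lambda>t. v t - (\<Sum>k\<in>F. a k * character k t)) < e" if "finite F" "G \<subseteq> F" for F
  proof -
    have "(\<Sum>k\<in>G. c k * character k t) = (\<Sum>k\<in>F. (if k \<in> G then c k else 0) * character k t)" for t
      using that by (intro sum.mono_neutral_cong_left) auto
    then show ?thesis
      using G(2) bessel_best_approximation[OF v that(1), of "\<lambda>k. if k \<in> G then c k else 0"]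
      unfolding a_def by simp
  qed
  then show "\<forall>\<^sub>F F in finite_subsets_at_top UNIV. msq (\<lambda>t. v t - (\<Sum>k\<in>F. a k * character k t)) < e"
    unfolding eventually_finite_subsets_at_top using G(1) by auto
next
  fix e :: real assume "e < 0"
  then show "\<forall>\<^sub>F F in finite_subsets_at_top UNIV. e < msq (\<lambda>t. v t - (\<Sum>k\<in>F. a k * character k t))"
    by (intro always_eventually allI) (use msq_nonneg in \<open>meson less_le_trans\<close>)
qed

text \<open>Parseval's identity for the pairing of \<open>u\<close> with \<open>v\<close>, shifted by \<open>m\<close>: the difference between the
  coefficient of the product and a finite sum is the pairing of \<open>u\<close> with the remainder of the Fourier
  series of \<open>v\<close>, which is small in mean square.\<close>

lemma fourier_coeff_product_has_sum:
  assumes u: "ess_bounded u" and v: "ess_bounded v"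
  shows "((\<lambda>k. mean (\<lambda>t. u t * character (k - m) t) * mean (\<lambda>t. v t * character (- k) t)) has_sum
    mean (\<lambda>t. u t * v t * character (- m) t)) UNIV"
proof -
  define a where "a k = mean (\<lambda>t. v t * character (- k) t)" for k
  define w where "w F t = v t - (\<Sum>k\<in>F. a k * character k t)" for F t
  have w: "ess_bounded (w F)" for F
    unfolding w_def by (intro ess_bounded_intros v)
  obtain C where C: "C > 0" "AE t in circle_measure. cmod (u t * character (- m) t) \<le> C"
    using ess_boundedE[OF ess_bounded_mult[OF u ess_bounded_char]] by metis
  have err: "mean (\<lambda>t. u t * v t * character (- m) t)
      - (\<Sum>k\<in>F. mean (\<lambda>t. u t * character (k - m) t) * a k)
      = mean (\<lambda>t. (u t * character (- m) t) * w F t * cnj 1)" for F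
  proof -
    have "(u t * character (- m) t) * w F t * cnj 1
        = u t * v t * character (- m) t - (\<Sum>k\<in>F. a k * (u t * character (k - m) t))" for t
    proof -
      have "character (k - m) t = character (- m) t * character k t" for k
        unfolding char_add by simp
      then show ?thesis
        by (simp add: w_def right_diff_distrib sum_distrib_left mult_ac)
    qed
    then have "mean (\<lambda>t. (u t * character (- m) t) * w F t * cnj 1)
        = mean (\<lambda>t. u t * v t * character (- m) t - (\<Sum>k\<in>F. a k * (u t * character (k - m) t)))"
      by presburger
    also have "\<dots>
        = mean (\<lambda>t. u t * v t * character (- m) t)
        - (\<Sum>k\<in>F. a k * mean (\<lambda>t. u t * character (k - m) t))"
      by (simp add: mean_diff mean_sum mean_cmult ess_bounded_intros u v del:
          of_int_diff of_int_minus)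
    finally show ?thesis by (simp add: mult.commute)
  qed
  have "((\<lambda>F. \<Sum>k\<in>F. mean (\<lambda>t. u t * character (k - m) t) * a k)
      \<longlongrightarrow> mean (\<lambda>t. u t * v t * character (- m) t))
      (finite_subsets_at_top UNIV)"
  proof (rule tendstoI)
    fix e :: real assume "e > 0"
    have lim: "((\<lambda>F. msq (w F)) \<longlongrightarrow> 0) (finite_subsets_at_top UNIV)"
      using fourier_series_mean_square[OF v] unfolding w_def a_def .
    have "(e / C)\<^sup>2 > 0"
      using \<open>e > 0\<close> C by simp
    from order_tendstoD(2)[OF lim this]
    show "\<forall>\<^sub>F F in finite_subsets_at_top UNIV.
        dist (\<Sum>k\<in>F. mean (\<lambda>t. u t * character (k - m) t) * a k)
            (mean (\<lambda>t. u t * v t * character (- m) t)) < e"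
    proof eventually_elim
      case (elim F)
      \<comment> \<open>The weight \<open>e / C\<close> balances the two terms when \<open>msq (w F) = (e / C)\<^sup>2\<close>.\<close>
      have "cmod (mean (\<lambda>t. (u t * character (- m) t) * w F t * cnj 1))
          \<le> C / 2 * (msq (w F) / (e / C) + e / C * msq (\<lambda>t. 1))"
        by (rule mean_mult_le[OF ess_bounded_mult[OF u ess_bounded_char] w ess_bounded_const])
          (use C \<open>e > 0\<close> in auto)
      also have "msq (\<lambda>t. 1) = 1"
        by (simp add: msq_def)
      also have "C / 2 * (msq (w F) / (e / C) + e / C * 1)
          < C / 2 * ((e / C)\<^sup>2 / (e / C) + e / C * 1)"
        using elim C \<open>e > 0\<close>
            by (intro mult_strict_left_mono add_strict_right_mono divide_strict_right_mono) auto
      also have "\<dots> = e"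
        using C \<open>e > 0\<close> by (simp add: power2_eq_square)
      finally show ?case
        unfolding err[symmetric] by (simp add: dist_norm norm_minus_commute)
    qed
  qed
  then show ?thesis
    by (simp add: has_sum_def a_def)
qed

section \<open>Boundedness of the operators\<close>

abbreviation bounded_symbol :: "(complex \<Rightarrow> complex) \<Rightarrow> bool" where
  "bounded_symbol f \<equiv> ess_bounded (\<lambda>t. f (cis t))"

lemma Linf_circle_bounded_symbol:
  assumes "f \<in> Linf_circle"
  shows "bounded_symbol f"
proof -
  have "(\<lambda>t. f (cis t)) \<in> borel_measurable circle_measure"
    using assms by (intro measurable_restrict_space1) (simp add: Linf_circle_def)
  moreover obtain C where "AE t in lebesgue. cmod (f (cis t)) \<le> C"
    using assms by (auto simp: Linf_circle_def)
  then have "AE t in lebesgue. t \<in> {0..2*pi} \<longrightarrow> cmod (f (cis t)) \<le> C"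
    by (rule eventually_mono) simp
  then have "AE t in circle_measure. cmod (f (cis t)) \<le> C"
    by (subst AE_restrict_space_iff) auto
  ultimately show ?thesis
    by (auto simp: ess_bounded_def)
qed

lemma fourier_coeff_eq_mean: "fourier_coeff f n = mean (\<lambda>t. f (cis t) * character (- n) t)"
proof -
  have "z / complex_of_real (2*pi) = z /\<^sub>R (2*pi)" for z
    by (simp only: scaleR_conv_of_real of_real_inverse divide_inverse_commute)
  moreover have "(LINT t:{0..2*pi}|lebesgue. h t) = (LINT t|circle_measure. h t)"
      for h :: "real \<Rightarrow> complex"
    by (simp add: set_lebesgue_integral_def integral_restrict_space)
  ultimately show ?thesis
    by (simp add: fourier_coeff_def mean_def)
qed

lemma fourier_coeff_cnj: "fourier_coeff (\<lambda>z. cnj (f z)) n = cnj (fourier_coeff f (- n))"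
  unfolding fourier_coeff_eq_mean mean_cnj[symmetric] by (simp add: cis_cnj)

lemma fourier_coeff_mult_has_sum:
  assumes "bounded_symbol f" "bounded_symbol g"
  shows "((\<lambda>k. fourier_coeff f (m - k) * fourier_coeff g k)
      has_sum fourier_coeff (\<lambda>z. f z * g z) m) UNIV"
  using fourier_coeff_product_has_sum[OF assms, of m] unfolding fourier_coeff_eq_mean by simp

lemma toeplitz_form_bound_nat:
  assumes f: "bounded_symbol f" "C > 0" "AE t in circle_measure. cmod (f (cis t)) \<le> C"
  shows "cmod (\<Sum>j\<le>N. \<Sum>k\<le>N. cnj (y j) * fourier_coeff f (int j - int k) * x k)
    \<le> C / 2 * ((\<Sum>k\<le>N. (cmod (x k))\<^sup>2) + (\<Sum>j\<le>N. (cmod (y j))\<^sup>2))"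
proof -
  have inj: "inj_on int {..N}" by simp
  have "(\<Sum>j\<le>N. \<Sum>k\<le>N. cnj (y j) * fourier_coeff f (int j - int k) * x k)
      = (\<Sum>j\<in>int ` {..N}. \<Sum>k\<in>int ` {..N}.
          cnj (y (nat j)) * mean (\<lambda>t. f (cis t) * character (k - j) t) * x (nat k))"
    by (simp add: sum.reindex fourier_coeff_eq_mean)
  also have "cmod \<dots>
      \<le> C / 2 * ((\<Sum>k\<in>int ` {..N}. (cmod (x (nat k)))\<^sup>2) + (\<Sum>j\<in>int ` {..N}. (cmod (y (nat j)))\<^sup>2))"
    by (rule toeplitz_form_bound) (use f in auto)
  finally show ?thesis
    by (simp add: sum.reindex)
qed

text \<open>Comparable vertices at levels \<open>j \<le> k\<close> have \<open>q ^ (n - k)\<close> common descendants at level \<open>n\<close>,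
  incomparable ones none. In other words, the weights of the kernels \<open>\<Gamma>[f]\<close> are a Gram matrix: that
  of the normalized indicator functions of the sets of descendants at level \<open>n\<close>. Half-integer powers
  of \<open>q\<close> are written as powers of its square root.\<close>

lemma card_common_extensions:
  fixes s t :: "'q::finite list"
  assumes "length s \<le> n" "length t \<le> n"
  defines "r \<equiv> sqrt (real CARD('q))"
  shows "real (card {w. length w = n \<and> prefix s w \<and> prefix t w}) * r ^ length s * r ^ length t =
    (if prefix s t \<or> prefix t s then r ^ (2 * n) / r ^ tree_dist s t else 0)"
proof -
  have r: "r > 0" "r\<^sup>2 = real CARD('q)"
    by (simp_all add: r_def)
  have *: "real (card {w. length w = n \<and> prefix s w \<and> prefix t w}) * r ^ length s * r ^ length t =
      r ^ (2 * n) / r ^ tree_dist s t"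
    if "prefix s t" "length t \<le> n" for s t :: "'q list"
  proof -
    have "{w. length w = n \<and> prefix s w \<and> prefix t w} = {w. length w = n \<and> prefix t w}"
      using that(1) by (auto intro: prefix_order.trans)
    then have "real (card {w. length w = n \<and> prefix s w \<and> prefix t w}) = r ^ (2 * (n - length t))"
      using card_words_extending[OF that(2)] by (simp add: power_mult r)
    moreover have "r ^ (2 * (n - length t)) * r ^ length s * r ^ length t
        * r ^ (length t - length s) = r ^ (2 * n)"
      unfolding power_add[symmetric] using that prefix_length_le[OF that(1)]
          by (intro arg_cong[where f = "power r"]) simp
    ultimately show ?thesis
      using r by (simp add: tree_dist_prefix[OF that(1)] field_simps)
  qed
  show ?thesis
  proof (cases "prefix s t \<or> prefix t s")
    case True
    then show ?thesis
      using *[of s t] *[of t s] assms(1,2) by (auto simp: conj_commute mult_ac tree_dist_sym)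
  next
    case False
    then have "{w. length w = n \<and> prefix s w \<and> prefix t w} = {}"
      using prefix_same_cases by auto
    with False show ?thesis by simp
  qed
qed

lemma sum_over_prefixes:
  assumes "finite F" "length w = N"
  shows "(\<Sum>s\<in>{s\<in>F. prefix s w}. h s)
      = (\<Sum>k\<le>N. if take k w \<in> F then h (take k w) else (0 :: 'b::comm_monoid_add))"
proof -
  have "(\<Sum>k\<le>N. if take k w \<in> F then h (take k w) else 0)
      = (\<Sum>k\<in>{k. k \<le> N \<and> take k w \<in> F}. h (take k w))"
    by (rule sum.mono_neutral_cong_right) auto
  also have "\<dots> = (\<Sum>s\<in>{s\<in>F. prefix s w}. h s)"
    by (rule sum.reindex_bij_witness[of _ length "\<lambda>k. take k w"])
       (use assms in \<open>auto simp: take_is_prefix min_def prefix_length_le elim!: prefixE\<close>)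
  finally show ?thesis by simp
qed

text \<open>Rays are cut off at a level \<open>N\<close> below which no vertex of \<open>F\<close> lies, and so become words \<open>w\<close>
  of length \<open>N\<close>. For each of them the vector \<open>X a w\<close> is the weighted restriction of \<open>a\<close> to the
  vertices between the root and \<open>w\<close>, and \<open>T w\<close> is the Toeplitz form along \<open>w\<close>. Counting common descendants turns the sum of the forms \<open>T w\<close> into
  \<open>q ^ N\<close> times the form of the kernel, and that of the squared norms of \<open>X a w\<close> into \<open>q ^ N\<close>
  times the squared norm of \<open>a\<close>.\<close>

lemma Gamma_form_bound:
  fixes F :: "'q::finite list set"
  assumes f: "bounded_symbol f" "C > 0" "AE t in circle_measure. cmod (f (cis t)) \<le> C"
      and "finite F"
  shows "cmod (\<Sum>s\<in>F. \<Sum>t\<in>F. cnj (b s) * Gamma_kernel f s t * a t)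
    \<le> C / 2 * ((\<Sum>s\<in>F. (cmod (a s))\<^sup>2) + (\<Sum>s\<in>F. (cmod (b s))\<^sup>2))"
proof -
  define r where "r = sqrt (real CARD('q))"
  have r: "r > 0" "r\<^sup>2 = real CARD('q)"
    by (simp_all add: r_def)
  define N where "N = Max (insert 0 (length ` F))"
  have N: "length s \<le> N" if "s \<in> F" for s
    using that \<open>finite F\<close> by (auto simp: N_def)
  define X where "X c w k = (if take k w \<in> F then of_real (r ^ k) * c (take k w) else 0)"
    for c :: "'q list \<Rightarrow> complex" and w k
  define T where "T w = (\<Sum>j\<le>N. \<Sum>k\<le>N. cnj (X b w j) * fourier_coeff f (int j - int k) * X a w k)"
      for w
  define e where "e s t = cnj (b s) * fourier_coeff f (int (length s) - int (length t)) * a t"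
      for s t
  have kernel: "of_real (r ^ (2 * N)) * (cnj (b s) * Gamma_kernel f s t * a t)
      = (\<Sum>w\<in>words N. if prefix s w \<and> prefix t w
          then of_real (r ^ length s) * of_real (r ^ length t) * e s t else 0)"
    if "s \<in> F" "t \<in> F" for s t
  proof -
    have "(\<Sum>w\<in>words N. if prefix s w \<and> prefix t w
        then of_real (r ^ length s) * of_real (r ^ length t) * e s t else 0)
        = (\<Sum>w\<in>{w. length w = N \<and> prefix s w \<and> prefix t w}.
            of_real (r ^ length s) * of_real (r ^ length t) * e s t)"
      by (rule sum.mono_neutral_cong_right) auto
    also have "\<dots>
        = of_real (real (card {w. length w = N \<and> prefix s w \<and> prefix t w}) * r ^ length s
        * r ^ length t) * e s t"
      by simp
    also have "\<dots> = of_real (r ^ (2 * N)) * (cnj (b s) * Gamma_kernel f s t * a t)"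
      unfolding card_common_extensions[OF N[OF that(1)] N[OF that(2)], folded r_def]
      by (auto simp: Gamma_kernel_comparable Gamma_kernel_incomparable e_def r_def)
    finally show ?thesis by simp
  qed
  have Tw: "(\<Sum>s\<in>F. \<Sum>t\<in>F. if prefix s w \<and> prefix t w
      then of_real (r ^ length s) * of_real (r ^ length t) * e s t else 0) = T w"
    if w: "length w = N" for w
  proof -
    have "(\<Sum>s\<in>F. \<Sum>t\<in>F. if prefix s w \<and> prefix t w
        then of_real (r ^ length s) * of_real (r ^ length t) * e s t else 0)
        = (\<Sum>s\<in>{s\<in>F. prefix s w}. \<Sum>t\<in>{t\<in>F. prefix t w}.
            of_real (r ^ length s) * of_real (r ^ length t) * e s t)"
      using \<open>finite F\<close>
      by (intro sum.mono_neutral_cong_right) (auto intro!: sum.neutral sum.mono_neutral_cong_right)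
    also have "\<dots> = T w"
      unfolding sum_over_prefixes[OF \<open>finite F\<close> w] T_def
      by (intro sum.cong refl) (auto simp: X_def e_def w if_distrib intro!: sum.cong sum.neutral)
    finally show ?thesis .
  qed
  have sq: "(\<Sum>w\<in>words N. \<Sum>k\<le>N. (cmod (X c w k))\<^sup>2) = r ^ (2 * N) * (\<Sum>s\<in>F. (cmod (c s))\<^sup>2)" for c
  proof -
    have "(\<Sum>w\<in>words N. \<Sum>k\<le>N. (cmod (X c w k))\<^sup>2)
        = (\<Sum>w\<in>words N. \<Sum>s\<in>{s\<in>F. prefix s w}. r ^ (2 * length s) * (cmod (c s))\<^sup>2)"
      using sum_over_prefixes[OF \<open>finite F\<close>, of _ N "\<lambda>s. r ^ (2 * length s) * (cmod (c s))\<^sup>2"] r(1)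
      by (intro sum.cong refl) (auto simp:
          X_def norm_mult norm_power power_mult_distrib power_mult[symmetric] mult.commute intro!:
          sum.cong)
    also have "\<dots>
        = (\<Sum>w\<in>words N. \<Sum>s\<in>F. if prefix s w then r ^ (2 * length s) * (cmod (c s))\<^sup>2 else 0)"
      using \<open>finite F\<close> by (intro sum.cong refl sum.mono_neutral_cong_left) auto
    also have "\<dots>
        = (\<Sum>s\<in>F. \<Sum>w\<in>words N. if prefix s w then r ^ (2 * length s) * (cmod (c s))\<^sup>2 else 0)"
      by (rule sum.swap)
    also have "\<dots> = (\<Sum>s\<in>F. r ^ (2 * N) * (cmod (c s))\<^sup>2)"
    proof (rule sum.cong[OF refl])
      fix s assume "s \<in> F"
      have "(\<Sum>w\<in>words N. if prefix s w then r ^ (2 * length s) * (cmod (c s))\<^sup>2 else 0)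
          = (\<Sum>w\<in>{w. length w = N \<and> prefix s w}. r ^ (2 * length s) * (cmod (c s))\<^sup>2)"
        by (rule sum.mono_neutral_cong_right) auto
      also have "\<dots> = r ^ (2 * (N - length s)) * (r ^ (2 * length s) * (cmod (c s))\<^sup>2)"
        by (simp add: card_words_extending[OF N[OF \<open>s \<in> F\<close>]] power_mult r)
      also have "\<dots> = r ^ (2 * N) * (cmod (c s))\<^sup>2"
      proof -
        have "2 * (N - length s) + 2 * length s = 2 * N"
          using N[OF \<open>s \<in> F\<close>] by simp
        then show ?thesis
          by (metis mult.assoc power_add)
      qed
      finally show "(\<Sum>w\<in>words N. if prefix s w then r ^ (2 * length s) * (cmod (c s))\<^sup>2 else 0)
          = r ^ (2 * N) * (cmod (c s))\<^sup>2" .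
    qed
    finally show ?thesis by (simp add: sum_distrib_left)
  qed
  have "of_real (r ^ (2 * N)) * (\<Sum>s\<in>F. \<Sum>t\<in>F. cnj (b s) * Gamma_kernel f s t * a t)
      = (\<Sum>s\<in>F. \<Sum>t\<in>F. \<Sum>w\<in>words N. if prefix s w \<and> prefix t w
          then of_real (r ^ length s) * of_real (r ^ length t) * e s t else 0)"
    unfolding sum_distrib_left by (intro sum.cong refl kernel)
  also have "\<dots> = (\<Sum>w\<in>words N. T w)"
    by (subst sum.swap[of _ _ F], subst sum.swap[of _ "words N" F]) (simp add: Tw)
  finally have "cmod (of_real (r ^ (2 * N)) * (\<Sum>s\<in>F. \<Sum>t\<in>F. cnj (b s) * Gamma_kernel f s t * a t))
      = cmod (\<Sum>w\<in>words N. T w)"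
    by (rule arg_cong)
  then have "r ^ (2 * N) * cmod (\<Sum>s\<in>F. \<Sum>t\<in>F. cnj (b s) * Gamma_kernel f s t * a t)
      = cmod (\<Sum>w\<in>words N. T w)"
    using r(1) by (simp only: norm_mult norm_of_real abs_of_pos zero_less_power)
  also have "\<dots> \<le> (\<Sum>w\<in>words N. C / 2 * ((\<Sum>k\<le>N. (cmod (X a w k))\<^sup>2) + (\<Sum>k\<le>N. (cmod (X b w k))\<^sup>2)))"
    unfolding T_def by (intro sum_norm_le toeplitz_form_bound_nat f)
  also have "\<dots> = r ^ (2 * N) * (C / 2 * ((\<Sum>s\<in>F. (cmod (a s))\<^sup>2) + (\<Sum>s\<in>F. (cmod (b s))\<^sup>2)))"
    unfolding sum_distrib_left[symmetric] sum.distrib sq by (simp add: algebra_simps)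
  finally show ?thesis
    using r(1) by simp
qed

lemma Gamma_op_represented:
  fixes f :: "complex \<Rightarrow> complex"
  assumes "bounded_symbol f"
  shows "bounded_clinear_ell2 (Gamma_op f :: 'q::finite list ell2 \<Rightarrow> 'q list ell2)"
    and "ell2_kernel (Gamma_op f :: 'q list ell2 \<Rightarrow> 'q list ell2) = Gamma_kernel f"
proof -
  obtain C where C: "C > 0" "AE t in circle_measure. cmod (f (cis t)) \<le> C"
    using assms by (rule ess_boundedE)
  obtain A :: "'q list ell2 \<Rightarrow> 'q list ell2"
    where A: "bounded_clinear_ell2 A" "ell2_kernel A = Gamma_kernel f"
    using bounded_kernel_represented[OF C(1) Gamma_form_bound[OF assms C]] by metis
  then have "Gamma_op f = A"
    unfolding Gamma_op_def by (intro operator_of_kernel_eqI)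
  with A show "bounded_clinear_ell2 (Gamma_op f :: 'q list ell2 \<Rightarrow> 'q list ell2)"
    "ell2_kernel (Gamma_op f :: 'q list ell2 \<Rightarrow> 'q list ell2) = Gamma_kernel f" by simp_all
qed

section \<open>Multiplicativity for analytic symbols\<close>

lemma bounded_clinear_ell2_compose:
  assumes "bounded_clinear_ell2 A" "bounded_clinear_ell2 B"
  shows "bounded_clinear_ell2 (A \<circ> B)"
  using assms bounded_linear_compose[of A B] by (simp add: bounded_clinear_ell2_def o_def)

lemma ell2_kernel_compose_has_sum:
  assumes "bounded_clinear_ell2 A"
  shows "((\<lambda>u. ell2_kernel A s u * ell2_kernel B u t) has_sum ell2_kernel (A \<circ> B) s t) UNIV"
  using bounded_clinear_ell2_kernel_has_sum[OF assms, of s "B (ell2_delta t)"]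
  by (simp add: ell2_kernel_eq)

lemma Gamma_product_kernel_has_sum:
  fixes s t :: "'q::finite list"
  assumes "bounded_symbol f" "bounded_symbol g"
  shows "((\<lambda>u. Gamma_kernel f s u * Gamma_kernel g u t)
      has_sum ell2_kernel (Gamma_op f \<circ> Gamma_op g) s t) UNIV"
  using ell2_kernel_compose_has_sum[OF Gamma_op_represented(1)[OF assms(1)], of s "Gamma_op g" t]
  by (simp add: Gamma_op_represented(2) assms)

lemma Gamma_kernel_adjoint: "Gamma_kernel (\<lambda>z. cnj (f z)) s t = cnj (Gamma_kernel f t s)"
proof (cases "prefix s t \<or> prefix t s")
  case True
  then show ?thesis
    using Gamma_kernel_comparable[of s t] Gamma_kernel_comparable[of t s]
    by (auto simp: fourier_coeff_cnj tree_dist_sym)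
next
  case False
  then show ?thesis by (simp add: Gamma_kernel_incomparable)
qed

text \<open>Analyticity of \<open>g\<close> restricts the sum to descendants \<open>u\<close> of \<open>t\<close>. At a level
  closer to the root than \<open>s\<close> at most one of them is comparable with \<open>s\<close>; from the level of \<open>s\<close> on,
  those comparable with \<open>s\<close> are the common descendants of \<open>s\<close> and \<open>t\<close>, of which there are just
  enough to make the weight independent of the level \<open>n\<close>.\<close>

lemma sum_Gamma_kernel_over_level:
  fixes s t :: "'q::finite list"
  assumes g: "\<And>n. n < 0 \<Longrightarrow> fourier_coeff g n = 0"
  shows "(\<Sum>u\<in>words n. Gamma_kernel f s u * Gamma_kernel g u t) =
    (if length t \<le> n \<and> (prefix s t \<or> prefix t s)
     then fourier_coeff f (int (length s) - int n) * fourier_coeff g (int n - int (length t))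
       / of_real (sqrt (real CARD('q))) ^ tree_dist s t
     else 0)"
proof -
  define r where "r = sqrt (real CARD('q))"
  have r: "r > 0" by (simp add: r_def)
  note kernel = Gamma_kernel_comparable[where 'q = 'q, folded r_def]
  have nz: "(prefix s u \<or> prefix u s) \<and> prefix t u"
    if "Gamma_kernel f s u * Gamma_kernel g u t \<noteq> 0" for u
  proof -
    have cmp: "prefix s u \<or> prefix u s" "prefix t u \<or> prefix u t"
      using that Gamma_kernel_incomparable by (metis mult_zero_left, metis mult_zero_right)
    have "\<not> length u < length t"
      using that g[of "int (length u) - int (length t)"] kernel[of u t g] cmp by auto
    then have "prefix t u"
      using cmp(2) by (metis not_le prefix_length_prefix prefix_order.refl)
    with cmp(1) show ?thesis by simp
  qed
  show ?thesis
  proof (cases "length t \<le> n \<and> (prefix s t \<or> prefix t s)")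
    case False
    have "Gamma_kernel f s u * Gamma_kernel g u t = 0" if "length u = n" for u
    proof (rule ccontr)
      assume "Gamma_kernel f s u * Gamma_kernel g u t \<noteq> 0"
      then have "prefix s u \<or> prefix u s" "prefix t u"
        using nz by blast+
      then show False
        using False that prefix_same_cases[of s u t] prefix_order.trans[of t u s] prefix_length_le[of t u]
        by auto
    qed
    then have "(\<Sum>u\<in>words n. Gamma_kernel f s u * Gamma_kernel g u t) = 0"
      by (intro sum.neutral) auto
    then show ?thesis by (simp only: if_not_P[OF False])
  next
    case True
    let ?c = "fourier_coeff f (int (length s) - int n) * fourier_coeff g (int n - int (length t))"
    show ?thesis
    proof (cases "length s \<le> n")
      case sn: True
      have "(\<Sum>u\<in>words n. Gamma_kernel f s u * Gamma_kernel g u t)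
          = (\<Sum>u\<in>{u. length u = n \<and> prefix s u \<and> prefix t u}.
              ?c / of_real (r ^ (n - length s) * r ^ (n - length t)))"
      proof (rule sum.mono_neutral_cong_right)
        show "\<forall>u\<in>words n - {u. length u = n \<and> prefix s u \<and> prefix t u}.
            Gamma_kernel f s u * Gamma_kernel g u t = 0"
        proof (intro ballI, rule ccontr)
          fix u assume u: "u \<in> words n - {u. length u = n \<and> prefix s u \<and> prefix t u}"
            and "Gamma_kernel f s u * Gamma_kernel g u t \<noteq> 0"
          then have "prefix s u \<or> prefix u s" "prefix t u"
            using nz by blast+
          then have "prefix s u"
            using u sn prefix_length_prefix[of s s u] by auto
          with u \<open>prefix t u\<close> show False by simp
        qed
        show "Gamma_kernel f s u * Gamma_kernel g u t
            = ?c / of_real (r ^ (n - length s) * r ^ (n - length t))"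
          if "u \<in> {u. length u = n \<and> prefix s u \<and> prefix t u}" for u
          using that by (simp add: kernel tree_dist_prefix tree_dist_sym[of u t])
      qed auto
      also have "\<dots>
          = ?c * of_real (real (card {u. length u = n \<and> prefix s u \<and> prefix t u})
          / (r ^ (n - length s) * r ^ (n - length t)))"
        by simp
      also have "real (card {u. length u = n \<and> prefix s u \<and> prefix t u})
          / (r ^ (n - length s) * r ^ (n - length t))
          = (real (card {u. length u = n \<and> prefix s u \<and> prefix t u}) * r ^ length s
              * r ^ length t) / r ^ (2 * n)"
      proof -
        have "r ^ length s * r ^ length t * (r ^ (n - length s) * r ^ (n - length t)) = r ^ (2 * n)"
          unfolding power_add[symmetric] using sn True by (intro arg_cong[where f = "power r"]) simp
        then show ?thesis using r by (simp add: field_simps)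
      qed
      also have "\<dots> = 1 / r ^ tree_dist s t"
        using card_common_extensions[OF sn, of t] True r by (simp add: r_def[symmetric])
      finally show ?thesis
        using True by (simp add: r_def)
    next
      case sn: False
      then have ts: "prefix t s"
        using True prefix_length_le[of s t] by auto
      have "(\<Sum>u\<in>words n. Gamma_kernel f s u * Gamma_kernel g u t)
          = (\<Sum>u\<in>{take n s}. ?c / of_real (r ^ tree_dist s t))"
      proof (rule sum.mono_neutral_cong_right)
        show "\<forall>u\<in>words n - {take n s}. Gamma_kernel f s u * Gamma_kernel g u t = 0"
        proof (intro ballI, rule ccontr)
          fix u assume u: "u \<in> words n - {take n s}"
              and "Gamma_kernel f s u * Gamma_kernel g u t \<noteq> 0"
          then have "prefix u s"
            using nz[of u] sn prefix_length_le[of s u] by auto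
          then show False
            using u by (auto elim!: prefixE)
        qed
        show "Gamma_kernel f s u * Gamma_kernel g u t = ?c / of_real (r ^ tree_dist s t)"
          if "u \<in> {take n s}" for u
        proof -
          have u: "length u = n" "prefix u s"
            using that sn by (simp_all add: take_is_prefix)
          then have "prefix t u"
            using ts True by (intro prefix_length_prefix[of t s u]) auto
          moreover have "r ^ (length s - n) * r ^ (n - length t) = r ^ (length s - length t)"
            unfolding power_add[symmetric] using sn True
                by (intro arg_cong[where f = "power r"]) simp
          ultimately show ?thesis
            using u ts by (simp add:
                kernel tree_dist_prefix tree_dist_sym[of s] tree_dist_sym[of u t]
                flip: of_real_power of_real_mult)
        qed
      qed (use sn in auto)
      then show ?thesis
        using True by (simp add: r_def)
    qed
  qed
qed

text \<open>The entry of the product is regrouped by the level of the intermediate vertex. With analytic \<open>g\<close>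
  the two-sided convolution is a sum over \<open>k \<ge> 0\<close>, where \<open>k\<close> is the depth below \<open>t\<close>.\<close>

lemma Gamma_kernel_product_analytic:
  fixes s t :: "'q::finite list"
  assumes f: "bounded_symbol f" and g: "bounded_symbol g"
    and neg: "\<And>n. n < 0 \<Longrightarrow> fourier_coeff g n = 0"
  shows "((\<lambda>u. Gamma_kernel f s u * Gamma_kernel g u t)
      has_sum Gamma_kernel (\<lambda>z. f z * g z) s t) UNIV"
proof -
  define S where "S = ell2_kernel (Gamma_op f \<circ> Gamma_op g) s t"
  define c where "c n = (\<Sum>u\<in>words n. Gamma_kernel f s u * Gamma_kernel g u t)" for n
  have S: "((\<lambda>u. Gamma_kernel f s u * Gamma_kernel g u t) has_sum S) UNIV"
    unfolding S_def by (rule Gamma_product_kernel_has_sum[OF f g])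
  have bij: "bij_betw snd (Sigma UNIV (\<lambda>n. words n :: 'q list set)) UNIV"
    by (rule bij_betwI[where g = "\<lambda>u. (length u, u)"]) auto
  have level: "c n = (if length t \<le> n \<and> (prefix s t \<or> prefix t s)
     then fourier_coeff f (int (length s) - int n) * fourier_coeff g (int n - int (length t))
       / of_real (sqrt (real CARD('q))) ^ tree_dist s t
     else 0)" for n
    unfolding c_def by (rule sum_Gamma_kernel_over_level) (rule neg)
  from has_sum_reindex_bij_betw[OF bij, THEN iffD2, OF S]
  have cS: "(c has_sum S) UNIV"
    by (rule has_sum_SigmaD) (simp add: c_def)
  have "S = Gamma_kernel (\<lambda>z. f z * g z) s t"
  proof (cases "prefix s t \<or> prefix t s")
    case False
    then have "c = (\<lambda>_. 0)"
      using level by auto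
    then have "S = 0"
      using has_sum_unique[OF cS, of 0] by simp
    with False show ?thesis
      by (simp add: Gamma_kernel_incomparable)
  next
    case True
    define R where "R = complex_of_real (sqrt (real CARD('q))) ^ tree_dist s t"
    let ?h = "\<lambda>k. fourier_coeff f (int (length s) - int (length t) - k) * fourier_coeff g k"
    have "(?h has_sum fourier_coeff (\<lambda>z. f z * g z) (int (length s) - int (length t))) UNIV"
      by (rule fourier_coeff_mult_has_sum[OF f g])
    also have "?this
        \<longleftrightarrow> (?h has_sum fourier_coeff (\<lambda>z. f z * g z) (int (length s) - int (length t))) {0..}"
      by (rule has_sum_cong_neutral) (use neg in auto)
    also have "\<dots>
        \<longleftrightarrow> ((\<lambda>n. fourier_coeff f (int (length s) - int n) * fourier_coeff g (int n - int (length t)))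
        has_sum fourier_coeff (\<lambda>z. f z * g z) (int (length s) - int (length t))) {length t..}"
      by (rule has_sum_reindex_bij_witness[of _ "\<lambda>n. int n - int (length t)"
          "\<lambda>k. nat (k + int (length t))"])
         (auto simp: algebra_simps)
    finally have "((\<lambda>n. fourier_coeff f (int (length s) - int n)
        * fourier_coeff g (int n - int (length t)) / R)
        has_sum fourier_coeff (\<lambda>z. f z * g z) (int (length s) - int (length t)) / R) {length t..}"
      by (rule has_sum_divide_const)
    also have "?this
        \<longleftrightarrow> (c has_sum fourier_coeff (\<lambda>z. f z * g z) (int (length s) - int (length t)) / R) UNIV"
      by (rule has_sum_cong_neutral)
         (use True in \<open>auto simp: level R_def\<close>)
    finally have "S = fourier_coeff (\<lambda>z. f z * g z) (int (length s) - int (length t)) / R"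
      by (rule has_sum_unique[OF cS])
    then show ?thesis
      using Gamma_kernel_comparable[OF True] by (simp add: R_def)
  qed
  with S show ?thesis by simp
qed

lemma Gamma_op_mult:
  fixes f g :: "complex \<Rightarrow> complex"
  assumes f: "bounded_symbol f" and g: "bounded_symbol g"
    and analytic: "(\<forall>n>0. fourier_coeff f n = 0) \<or> (\<forall>n<0. fourier_coeff g n = 0)"
  shows "Gamma_op f \<circ> Gamma_op g
      = (Gamma_op (\<lambda>z. f z * g z) :: 'q::finite list ell2 \<Rightarrow> 'q list ell2)"
proof (rule bounded_clinear_ell2_eqI)
  have fg: "bounded_symbol (\<lambda>z. f z * g z)"
    by (intro ess_bounded_intros f g)
  show "bounded_clinear_ell2 (Gamma_op f \<circ> Gamma_op g :: 'q list ell2 \<Rightarrow> 'q list ell2)"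
    by (intro bounded_clinear_ell2_compose Gamma_op_represented f g)
  show "bounded_clinear_ell2 (Gamma_op (\<lambda>z. f z * g z) :: 'q list ell2 \<Rightarrow> 'q list ell2)"
    by (rule Gamma_op_represented[OF fg])
  have "((\<lambda>u. Gamma_kernel f s u * Gamma_kernel g u t)
      has_sum Gamma_kernel (\<lambda>z. f z * g z) s t) UNIV"
    for s t :: "'q list"
    using analytic
  proof
    assume "\<forall>n<0. fourier_coeff g n = 0"
    then show ?thesis
      by (intro Gamma_kernel_product_analytic f g) auto
  next
    assume "\<forall>n>0. fourier_coeff f n = 0"
    then have neg: "fourier_coeff (\<lambda>z. cnj (f z)) n = 0" if "n < 0" for n
      using that by (simp add: fourier_coeff_cnj)
    have "((\<lambda>u. Gamma_kernel (\<lambda>z. cnj (g z)) t u * Gamma_kernel (\<lambda>z. cnj (f z)) u s)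
        has_sum Gamma_kernel (\<lambda>z. cnj (g z) * cnj (f z)) t s) UNIV"
      by (intro Gamma_kernel_product_analytic ess_bounded_intros f g neg)
    moreover have "(\<lambda>z. cnj (g z) * cnj (f z)) = (\<lambda>z. cnj (f z * g z))"
      by (simp add: mult.commute)
    then have "Gamma_kernel (\<lambda>z. cnj (g z) * cnj (f z)) t s
        = cnj (Gamma_kernel (\<lambda>z. f z * g z) s t)"
      by (simp only: Gamma_kernel_adjoint)
    ultimately have "((\<lambda>u. cnj (Gamma_kernel f s u * Gamma_kernel g u t))
        has_sum cnj (Gamma_kernel (\<lambda>z. f z * g z) s t)) UNIV"
      by (simp add: Gamma_kernel_adjoint mult.commute)
    then show ?thesis
      by (simp only: has_sum_cnj_iff)
  qed
  then show "ell2_kernel (Gamma_op f \<circ> Gamma_op g)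
      = ell2_kernel (Gamma_op (\<lambda>z. f z * g z) :: 'q list ell2 \<Rightarrow> 'q list ell2)"
    unfolding Gamma_op_represented(2)[OF fg]
    by (intro ext has_sum_unique[OF Gamma_product_kernel_has_sum[OF f g]])
qed

section \<open>Compactness forces analyticity\<close>

text \<open>A vertex comparable with both \<open>s\<close> and \<open>t\<close> is the branch point \<open>p\<close> or an ancestor of it;
  the index \<open>i\<close> is its distance to \<open>p\<close>. Hence no infinite sum occurs in these entries.\<close>

lemma Gamma_product_kernel_branching:
  fixes p s' t' :: "'q::finite list"
  assumes f: "bounded_symbol f" and g: "bounded_symbol g" and "x \<noteq> y"
  defines "s \<equiv> p @ x # s'" and "t \<equiv> p @ y # t'"
  shows "ell2_kernel (Gamma_op f \<circ> Gamma_op g) s t =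
    (\<Sum>i\<le>length p. fourier_coeff f (int (Suc (length s')) + int i)
        * fourier_coeff g (- int (Suc (length t')) - int i)
        / of_nat CARD('q) ^ i) / of_real (sqrt (real CARD('q)))
          ^ (Suc (length s') + Suc (length t'))"
proof -
  define r where "r = complex_of_real (sqrt (real CARD('q)))"
  have r2: "r\<^sup>2 = of_nat CARD('q)"
    unfolding r_def of_real_power[symmetric] by simp
  have r: "r \<noteq> 0" by (simp add: r_def)
  have inc: "\<not> prefix s t" "\<not> prefix t s"
    using \<open>x \<noteq> y\<close> by (auto simp: s_def t_def)
  have only_prefixes: "prefix u p" if "Gamma_kernel f s u * Gamma_kernel g u t \<noteq> 0" for u
  proof -
    have "prefix s u \<or> prefix u s" "prefix t u \<or> prefix u t"
      using that Gamma_kernel_incomparable by (metis mult_zero_left, metis mult_zero_right)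
    then have "prefix u s" "prefix u t"
      using inc prefix_same_cases[of s u t] prefix_order.trans[of s u t] prefix_order.trans[of t u s] by auto
    then show ?thesis
      using \<open>x \<noteq> y\<close> unfolding s_def t_def by (auto simp: prefix_append prefix_Cons)
  qed
  have "finite {u. prefix u p}"
    by (simp flip: in_set_prefixes)
  then have "((\<lambda>u. Gamma_kernel f s u * Gamma_kernel g u t) has_sum
      (\<Sum>u\<in>{u. prefix u p}. Gamma_kernel f s u * Gamma_kernel g u t)) UNIV"
    by (rule has_sum_finite_neutralI[of "{u. prefix u p}"])
       (use only_prefixes in auto)
  then have "ell2_kernel (Gamma_op f \<circ> Gamma_op g) s t
      = (\<Sum>u\<in>{u. prefix u p}. Gamma_kernel f s u * Gamma_kernel g u t)"
    by (rule has_sum_unique[OF Gamma_product_kernel_has_sum[OF f g]])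
  also have "\<dots>
      = (\<Sum>i\<le>length p. Gamma_kernel f s (take (length p - i) p)
      * Gamma_kernel g (take (length p - i) p) t)"
    by (rule sum.reindex_bij_witness[of _ "\<lambda>i. take (length p - i) p" "\<lambda>u. length p - length u"])
       (auto simp: take_is_prefix prefix_length_le elim!: prefixE)
  also have "\<dots>
      = (\<Sum>i\<le>length p. fourier_coeff f (int (Suc (length s')) + int i)
      * fourier_coeff g (- int (Suc (length t')) - int i)
        / of_nat CARD('q) ^ i / r ^ (Suc (length s') + Suc (length t')))"
  proof (rule sum.cong[OF refl])
    fix i assume "i \<in> {..length p}"
    then have i: "i \<le> length p" by simp
    define u where "u = take (length p - i) p"
    have u: "prefix u s" "prefix u t" "length u = length p - i"
      using i by (auto simp: u_def s_def t_def take_is_prefix intro: prefix_order.trans)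
    have "tree_dist s u = Suc (length s') + i" "tree_dist u t = Suc (length t') + i"
      using u i by (simp_all add: tree_dist_sym[of s] tree_dist_prefix) (simp_all add: s_def t_def)
    then have "Gamma_kernel f s u * Gamma_kernel g u t
        = (fourier_coeff f (int (length s) - int (length u)) / r ^ (Suc (length s') + i))
          * (fourier_coeff g (int (length u) - int (length t)) / r ^ (Suc (length t') + i))"
      using u by (simp add: Gamma_kernel_comparable r_def del: power_Suc)
    also have "int (length s) - int (length u) = int (Suc (length s')) + int i"
      using u(3) i by (simp add: s_def)
    also have "int (length u) - int (length t) = - int (Suc (length t')) - int i"
      using u(3) i by (simp add: t_def)
    also have "r ^ (Suc (length s') + i) = r ^ Suc (length s') * r ^ i"
      by (rule power_add)
    also have "r ^ (Suc (length t') + i) = r ^ Suc (length t') * r ^ i"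
      by (rule power_add)
    finally show "Gamma_kernel f s (take (length p - i) p)
        * Gamma_kernel g (take (length p - i) p) t
        = fourier_coeff f (int (Suc (length s')) + int i)
            * fourier_coeff g (- int (Suc (length t')) - int i)
        / of_nat CARD('q) ^ i / r ^ (Suc (length s') + Suc (length t'))"
      unfolding u_def[symmetric] power_add r2[symmetric] power_mult[symmetric] mult_2
      by (simp add: power_add mult_ac)
  qed
  finally show ?thesis
    by (simp add: sum_divide_distrib r_def)
qed

text \<open>The branch point moves down along the ray \<open>x x x \<dots>\<close> while the distances of the two vertices to
  it stay fixed. The sums \<open>M c a b\<close> and \<open>M c (Suc a) (Suc b)\<close> both tend to \<open>0\<close>, and the recursion
  between them isolates a single product of coefficients. That there are two different letters is where
  \<open>q \<ge> 2\<close> enters.\<close>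

lemma compact_semicommutator_coeff_zero:
  fixes f g :: "complex \<Rightarrow> complex"
  assumes q: "CARD('q::finite) \<ge> 2" and f: "bounded_symbol f" and g: "bounded_symbol g"
    and cpt: "compact_operator_ell2 (\<lambda>x :: 'q list ell2. Gamma_op f (Gamma_op g x)
        - Gamma_op (\<lambda>z. f z * g z) x)"
  shows "fourier_coeff f (int (Suc a)) * fourier_coeff g (- int (Suc b)) = 0"
proof -
  define D where "D x = Gamma_op f (Gamma_op g x) - Gamma_op (\<lambda>z. f z * g z) x"
      for x :: "'q list ell2"
  have cptD: "compact_operator_ell2 D"
    using cpt unfolding D_def .
  obtain x y :: 'q where "x \<noteq> y"
    using q card_le_Suc0_iff_eq[of "UNIV :: 'q set"] by auto
  define M where "M c a b
      = (\<Sum>i\<le>c. fourier_coeff f (int (Suc a) + int i) * fourier_coeff g (- int (Suc b) - int i)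
      / of_nat CARD('q) ^ i)"
    for c a b
  have fg: "bounded_symbol (\<lambda>z. f z * g z)"
    by (intro ess_bounded_intros f g)
  have lim: "(\<lambda>c. M c a b) \<longlonglongrightarrow> 0" for a b
  proof -
    define R where "R = complex_of_real (sqrt (real CARD('q))) ^ (Suc a + Suc b)"
    have "R \<noteq> 0" by (simp add: R_def)
    define s where "s c = replicate c x @ x # replicate a x" for c
    define t where "t c = replicate c x @ y # replicate b x" for c
    have len: "length (s c) = c + Suc a" for c
      by (simp add: s_def)
    have D: "ell2_kernel D (s c) (t c) = M c a b / R" for c
    proof -
      have "ell2_kernel D (s c) (t c) = ell2_kernel (Gamma_op f \<circ> Gamma_op g) (s c) (t c)
          - ell2_kernel (Gamma_op (\<lambda>z. f z * g z)) (s c) (t c)"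
        by (simp add: ell2_kernel_eq D_def)
      also have "ell2_kernel (Gamma_op (\<lambda>z. f z * g z)) (s c) (t c) = 0"
        using \<open>x \<noteq> y\<close> unfolding Gamma_op_represented(2)[OF fg]
        by (intro Gamma_kernel_incomparable) (auto simp: s_def t_def)
      finally show ?thesis
        unfolding s_def t_def Gamma_product_kernel_branching[OF f g \<open>x \<noteq> y\<close>]
        by (simp add: M_def R_def)
    qed
    have "(\<lambda>c. M c a b / R) \<longlonglongrightarrow> 0"
    proof (rule tendstoI)
      fix e :: real assume "e > 0"
      have "inj s"
        using len by (metis add_right_cancel injI)
      then have "finite (s -` {s. \<exists>t. cmod (ell2_kernel D s t) \<ge> e})"
        by (intro finite_vimageI compact_operator_ell2_kernel_vanishes[OF cptD \<open>e > 0\<close>])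
      then have "finite {c. \<not> dist (M c a b / R) 0 < e}"
        by (rule rev_finite_subset) (auto simp: not_less D[symmetric])
      then show "\<forall>\<^sub>F c in sequentially. dist (M c a b / R) 0 < e"
        by (simp add: cofinite_eq_sequentially[symmetric] eventually_cofinite)
    qed
    from tendsto_mult_right[OF this, of R] show ?thesis
      using \<open>R \<noteq> 0\<close> by simp
  qed
  have "M (Suc c) a b = fourier_coeff f (int (Suc a)) * fourier_coeff g (- int (Suc b))
      + M c (Suc a) (Suc b) / of_nat CARD('q)" for c
  proof -
    have idx: "int (Suc a) + int (Suc i) = int (Suc (Suc a)) + int i"
      "- int (Suc b) - int (Suc i) = - int (Suc (Suc b)) - int i" for i
      by simp_all
    then show ?thesis
      unfolding M_def sum.atMost_Suc_shift sum_divide_distrib idx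
      by (simp add: divide_divide_eq_left mult.commute del: of_nat_Suc)
  qed
  then have eq: "(\<lambda>c. M (Suc c) a b)
      = (\<lambda>c. fourier_coeff f (int (Suc a)) * fourier_coeff g (- int (Suc b)) + M c (Suc a) (Suc b)
      / of_nat CARD('q))"
    by blast
  have "(\<lambda>c. M (Suc c) a b)
      \<longlonglongrightarrow> fourier_coeff f (int (Suc a)) * fourier_coeff g (- int (Suc b)) + 0 / of_nat CARD('q)"
    unfolding eq by (intro tendsto_intros lim) simp
  from LIMSEQ_unique[OF this LIMSEQ_Suc[OF lim]] show ?thesis
    by (simp only: div_0 add_0_right)
qed

lemma compact_operator_ell2_zero: "compact_operator_ell2 (\<lambda>x. 0)"
proof -
  have "(\<lambda>x :: 'a ell2. 0 :: 'b ell2) ` cball 0 1 = {0}"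
    by (auto simp: image_constant_conv)
  moreover have "ell2_scale c (0 :: 'b ell2) = 0" for c
    by (rule ell2_eqI) simp
  ultimately show ?thesis
    by (simp add: compact_operator_ell2_def bounded_clinear_ell2_def)
qed

theorem corollary1p9:
  fixes f g :: "complex \<Rightarrow> complex"
  assumes "CARD('q::finite) \<ge> 2"
    and "f \<in> Linf_circle" and "g \<in> Linf_circle"
  shows "(compact_operator_ell2
            (\<lambda>x :: 'q tree ell2.
               Gamma_op (\<lambda>z. cnj (f z)) (Gamma_op g x) - Gamma_op (\<lambda>z. cnj (f z) * g z) x)
          \<longleftrightarrow> Gamma_op (\<lambda>z. cnj (f z)) \<circ> Gamma_op g
              = (Gamma_op (\<lambda>z. cnj (f z) * g z) :: 'q tree ell2 \<Rightarrow> 'q tree ell2))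
       \<and> (compact_operator_ell2
            (\<lambda>x :: 'q tree ell2.
               Gamma_op (\<lambda>z. cnj (f z)) (Gamma_op g x) - Gamma_op (\<lambda>z. cnj (f z) * g z) x)
          \<longleftrightarrow> f \<in> Hinf_circle \<or> g \<in> Hinf_circle)"
    (is "(?compact \<longleftrightarrow> ?mult) \<and> (?compact \<longleftrightarrow> ?Hinf)")
proof -
  have g: "bounded_symbol g" and f: "bounded_symbol (\<lambda>z. cnj (f z))"
    using assms by (auto intro: ess_bounded_cnj Linf_circle_bounded_symbol)
  have "?Hinf" if ?compact
  proof (rule ccontr)
    assume "\<not> ?Hinf"
    then obtain m n where mn: "m < 0" "fourier_coeff f m \<noteq> 0" "n < 0" "fourier_coeff g n \<noteq> 0"
      using assms(2,3) by (auto simp: Hinf_circle_def)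
    define a b where "a = nat (- m) - 1" and "b = nat (- n) - 1"
    have "- m = int (Suc a)" "n = - int (Suc b)"
      using mn by (simp_all add: a_def b_def)
    moreover have "fourier_coeff (\<lambda>z. cnj (f z)) (- m) * fourier_coeff g n \<noteq> 0"
      using mn by (simp add: fourier_coeff_cnj)
    ultimately show False
      using compact_semicommutator_coeff_zero[OF assms(1) f g that, of a b] by metis
  qed
  moreover have ?mult if ?Hinf
    using that by (intro Gamma_op_mult f g) (auto simp: Hinf_circle_def fourier_coeff_cnj)
  moreover have ?compact if ?mult
  proof -
    have "(\<lambda>x :: 'q tree ell2. Gamma_op (\<lambda>z. cnj (f z)) (Gamma_op g x)
        - Gamma_op (\<lambda>z. cnj (f z) * g z) x) = (\<lambda>x. 0)"
      using fun_cong[OF that] by (simp add: fun_eq_iff)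
    then show ?thesis
      by (simp only: compact_operator_ell2_zero)
  qed
  ultimately show ?thesis by blast
qed

end
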